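(* There exists a weak solution $(\widetilde U,\widetilde v,\widetilde\lambda)$, with $\widetilde U\in H^1_{\mathrm{loc}}(\mathbb{R}^3;\mathbb{R}^3)$, $\widetilde v\in H^1(\mathbb{R}^3;\mathbb{R}^3)$, $\widetilde v\neq0$, and $\widetilde\lambda\in\mathbb{R}$, of the system $$\begin{cases}-\frac12\widetilde U-\frac12\xi\cdot\nabla\widetilde U+\Pi(\widetilde U\cdot\nabla\widetilde U)-\Delta\widetilde U=0,\\[2pt] -\frac12\widetilde v-\frac12\xi\cdot\nabla\widetilde v+\Pi(\widetilde U\cdot\nabla\widetilde v+\widetilde v\cdot\nabla\widetilde U)-\Delta\widetilde v=\widetilde\lambda\,\widetilde v,\qquad\widetilde\lambda<0,\\[2pt] \operatorname{div}\widetilde U=0,\\ \operatorname{div}\widetilde v=0,\end{cases}$$ on $\mathbb{R}^3$.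
   Context: $\xi\in\mathbb{R}^3$ is the space variable and $\Pi$ is the Leray projection onto divergence-free fields. The Leray-projection and pressure formulations are interchangeable: the first two equations are understood in the distributional sense, i.e. they hold when tested against divergence-free fields in $C_c^\infty(\mathbb{R}^3;\mathbb{R}^3)$ (equivalently, the projected terms are replaced by $\widetilde U\cdot\nabla\widetilde U+\nabla\widetilde P$ and $\widetilde U\cdot\nabla\widetilde v+\widetilde v\cdot\nabla\widetilde U+\nabla\widetilde q$ for pressures $\widetilde P,\widetilde q$). *)

theory Defs
  imports "HOL-Analysis.Analysis"
begin

primrec continuously_differentiable ::
    "nat \<Rightarrow> ('a::euclidean_space \<Rightarrow> 'b::real_normed_vector) \<Rightarrow> bool" where
  "continuously_differentiable 0 f \<longleftrightarrow> continuous_on UNIV f"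
| "continuously_differentiable (Suc k) f \<longleftrightarrow>
     (\<forall>x. f differentiable (at x)) \<and>
     (\<forall>b\<in>Basis. continuously_differentiable k (\<lambda>x. frechet_derivative f (at x) b))"

definition test_function :: "('a::euclidean_space \<Rightarrow> 'b::real_normed_vector) \<Rightarrow> bool" where
  "test_function \<phi> \<longleftrightarrow>
     (\<forall>k. continuously_differentiable k \<phi>) \<and> compact (closure {x. \<phi> x \<noteq> 0})"

text \<open>The Jacobian has the entry \<open>\<partial>\<^sub>j \<phi>\<^sub>i\<close> in row \<open>i\<close> and column \<open>j\<close>; weak gradients below
  follow the same convention. Hence \<open>DV x *v U x\<close> is \<open>(U \<cdot> \<nabla>V)(x)\<close>, and the inner
  product of two such matrices is \<open>\<Sum>\<^sub>i \<Sum>\<^sub>j \<partial>\<^sub>j V\<^sub>i \<partial>\<^sub>j \<phi>\<^sub>i\<close>.\<close>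

definition jacobian_at :: "(real^'n \<Rightarrow> real^'m) \<Rightarrow> real^'n \<Rightarrow> real^'n^'m" where
  "jacobian_at \<phi> x = matrix (frechet_derivative \<phi> (at x))"

definition solenoidal_test_field :: "(real^'n \<Rightarrow> real^'n) \<Rightarrow> bool" where
  "solenoidal_test_field \<phi> \<longleftrightarrow> test_function \<phi> \<and> (\<forall>x. trace (jacobian_at \<phi> x) = 0)"

definition locally_integrable :: "('a::euclidean_space \<Rightarrow> 'b::euclidean_space) \<Rightarrow> bool" where
  "locally_integrable f \<longleftrightarrow>
     f \<in> borel_measurable lborel \<and> (\<forall>K. compact K \<longrightarrow> set_integrable lborel K f)"

definition L2 :: "('a::euclidean_space \<Rightarrow> 'b::euclidean_space) set" where
  "L2 = {f \<in> borel_measurable lborel. integrable lborel (\<lambda>x. (norm (f x))\<^sup>2)}"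

definition L2_loc :: "('a::euclidean_space \<Rightarrow> 'b::euclidean_space) set" where
  "L2_loc = {f \<in> borel_measurable lborel.
     \<forall>K. compact K \<longrightarrow> set_integrable lborel K (\<lambda>x. (norm (f x))\<^sup>2)}"

definition has_weak_gradient ::
    "(real^'n \<Rightarrow> real^'m) \<Rightarrow> (real^'n \<Rightarrow> real^'n^'m) \<Rightarrow> bool" where
  "has_weak_gradient f G \<longleftrightarrow>
     locally_integrable f \<and> locally_integrable G \<and>
     (\<forall>(\<psi> :: real^'n \<Rightarrow> real) i j. test_function \<psi> \<longrightarrow>
        (\<integral>x. f x $ i * frechet_derivative \<psi> (at x) (axis j 1) \<partial>lborel)
          = - (\<integral>x. G x $ i $ j * \<psi> x \<partial>lborel))"

definition H1 :: "(real^'n \<Rightarrow> real^'m) set" where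
  "H1 = {f \<in> L2. \<exists>G \<in> L2. has_weak_gradient f G}"

definition H1_loc :: "(real^'n \<Rightarrow> real^'m) set" where
  "H1_loc = {f \<in> L2_loc. \<exists>G \<in> L2_loc. has_weak_gradient f G}"

text \<open>A weak gradient is unique almost everywhere, so it does not matter in the following
  definitions which one is chosen.\<close>

definition weakly_divergence_free :: "(real^'n \<Rightarrow> real^'n) \<Rightarrow> bool" where
  "weakly_divergence_free U \<longleftrightarrow>
     (\<exists>DU. has_weak_gradient U DU \<and> (AE x in lborel. trace (DU x) = 0))"

text \<open>The two equations tested against divergence-free fields, which removes the pressure
  gradient. For \<open>U \<in> H1_loc\<close> and \<open>v \<in> H1\<close> every term of the integrands is integrable.\<close>

definition weak_profile_equation :: "(real^3 \<Rightarrow> real^3) \<Rightarrow> bool" where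
  "weak_profile_equation U \<longleftrightarrow>
     (\<exists>DU. has_weak_gradient U DU \<and>
        (\<forall>\<phi>. solenoidal_test_field \<phi> \<longrightarrow>
           (\<integral>\<xi>. (- (1/2) *\<^sub>R U \<xi> - (1/2) *\<^sub>R (DU \<xi> *v \<xi>) + DU \<xi> *v U \<xi>) \<bullet> \<phi> \<xi>
                + DU \<xi> \<bullet> jacobian_at \<phi> \<xi> \<partial>lborel) = 0))"

definition weak_eigenvalue_equation ::
    "(real^3 \<Rightarrow> real^3) \<Rightarrow> (real^3 \<Rightarrow> real^3) \<Rightarrow> real \<Rightarrow> bool" where
  "weak_eigenvalue_equation U v \<mu> \<longleftrightarrow>
     (\<exists>DU Dv. has_weak_gradient U DU \<and> has_weak_gradient v Dv \<and>
        (\<forall>\<phi>. solenoidal_test_field \<phi> \<longrightarrow>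
           (\<integral>\<xi>. (- (1/2) *\<^sub>R v \<xi> - (1/2) *\<^sub>R (Dv \<xi> *v \<xi>)
                 + (Dv \<xi> *v U \<xi> + DU \<xi> *v v \<xi>)) \<bullet> \<phi> \<xi>
                + Dv \<xi> \<bullet> jacobian_at \<phi> \<xi> \<partial>lborel)
             = (\<integral>\<xi>. (\<mu> *\<^sub>R v \<xi>) \<bullet> \<phi> \<xi> \<partial>lborel)))"

end

theory Submission
  imports Defs "HOL-Real_Asymp.Real_Asymp"
begin

text \<open>The profile is the linear strain flow \<open>U \<xi> = A \<xi>\<close> with \<open>A = diag (9/20, 9/20, - 9/10)\<close>. It is the
  gradient of a harmonic polynomial, so all its self-similar and inertial terms are gradients and it
  solves the profile equation with a suitable pressure; it grows at infinity, but it lies in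
  \<open>H1_loc\<close>.

  Because \<open>A\<close> is symmetric, \<open>U \<cdot> \<nabla>v + v \<cdot> \<nabla>U\<close> is a gradient whenever \<open>v\<close> is one. The
  linearised operator therefore acts modulo gradients, and on fields \<open>g e\<^sub>3\<close> it becomes the scalar
  Ornstein-Uhlenbeck operator \<open>- \<Delta> + (A - 1/2) \<xi> \<cdot> \<nabla>\<close> plus the constant \<open>- 9/10 - 1/2\<close>. Its contraction rates are
  \<open>\<beta> = (1/20, 1/20, 7/5)\<close>. The Gaussian in equilibrium with the drift has Ornstein-Uhlenbeck
  eigenvalue \<open>\<Sum> \<beta>\<^sub>i = 3/2\<close>, hence total eigenvalue \<open>1/10\<close>, just on the wrong side of zero. Multiplying its
  Fourier transform by \<open>\<bar>k\<^sub>3\<bar> powr (- 1/8)\<close> keeps it square integrable and lowers the eigenvalue by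
  \<open>\<beta>\<^sub>3 / 8 = 7/40\<close>, to \<open>- 3/40 < 0\<close>. The eigenfield \<open>v\<close> is the Leray projection of the resulting field.

  Both non-local operations are written as integrals of Gaussians, which avoids the Fourier
  transform. The singular factor is an integral over Gaussians stretched vertically by \<open>r ^ 16\<close>, and the
  inverse Laplacian in the Leray projection is an integral over the heat flow time \<open>t\<close>. So \<open>v\<close> is an
  explicit double integral of the fields \<open>curl (curl (G e\<^sub>3))\<close>, with \<open>G\<close> a Gaussian depending on
  \<open>(r, t)\<close>. For one such field the eigenvalue equation holds up to a gradient and a residual in the third
  component (\<open>linearized_operator_mode\<close>). The residual is a derivative in \<open>t\<close> whose boundary value
  is a derivative in \<open>r\<close>, so its double integral vanishes (\<open>superposition_residual_eq_0\<close>).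

  The rest is integrability: every Gaussian derivative that is averaged is bounded by an integrable
  function of \<open>(r, t)\<close> times a square integrable function of \<open>x\<close> (\<open>mode_superposable_bound\<close>). This puts
  \<open>v\<close> into \<open>H1\<close> and justifies all exchanges of integrals. Finally \<open>v\<close> is not zero, since near the origin
  the third component of every mode is positive.\<close>

section \<open>Integration by parts without boundary terms\<close>

lemma integrable_continuous_compact_support:
  fixes f :: "'a::euclidean_space \<Rightarrow> real"
  assumes "continuous_on UNIV f" "compact K" "\<And>x. x \<notin> K \<Longrightarrow> f x = 0"
  shows "integrable lborel f"
proof -
  have "set_integrable lborel K f"
    unfolding set_integrable_def
    by (rule borel_integrable_compact[OF assms(2) continuous_on_subset[OF assms(1)]]) simp
  moreover have "(\<lambda>x. indicator K x *\<^sub>R f x) = f"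
    using assms(3) by (auto simp: indicator_def fun_eq_iff)
  ultimately show ?thesis by (simp add: set_integrable_def)
qed

lemma derivative_eq_0_outside:
  assumes "\<And>x. (F has_derivative F' x) (at x)" "closed K" "\<And>x. x \<notin> K \<Longrightarrow> F x = 0" "x \<notin> K"
  shows "F' x = (\<lambda>h. 0)"
proof -
  have "open (- K)" using assms(2) by auto
  hence "((\<lambda>x. 0) has_derivative F' x) (at x)"
    using has_derivative_transform_within_open[OF assms(1)[of x], of "-K" "\<lambda>x. 0"] assms(3,4) by auto
  thus ?thesis
    using has_derivative_unique has_derivative_const by blast
qed

text \<open>Translation invariance of Lebesgue measure makes every difference quotient of a compactly
  supported function integrate to zero, and dominated convergence passes this on to the
  derivative. No coordinates have to be singled out, as they would be in an iterated integral.\<close>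

lemma integral_directional_derivative_eq_0:
  fixes F :: "'a::euclidean_space \<Rightarrow> real"
  assumes der: "\<And>x. (F has_derivative F' x) (at x)"
    and cont: "continuous_on UNIV (\<lambda>x. F' x b)"
    and K: "compact K" and zero: "\<And>x. x \<notin> K \<Longrightarrow> F x = 0"
  shows "(\<integral>x. F' x b \<partial>lborel) = 0"
proof -
  obtain R where R: "K \<subseteq> cball 0 R"
    using compact_imp_bounded[OF K] by (auto simp: bounded_iff subset_iff)
  \<comment> \<open>The step sizes stay below 1, so the supports of all difference quotients lie in one ball.\<close>
  define h where "h = (\<lambda>n::nat. 1 / (real n + 1))"
  have h0: "0 < h n" "h n \<le> 1" for n by (auto simp: h_def)
  define q where "q = (\<lambda>n x. (F (x + h n *\<^sub>R b) - F x) / h n)"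
  have contF: "continuous_on UNIV F"
    using der by (meson continuous_at_imp_continuous_on has_derivative_continuous)
  have intF: "integrable lborel F"
    by (rule integrable_continuous_compact_support[OF contF K zero])
  have Fm [measurable]: "F \<in> borel_measurable borel"
    using contF by (rule borel_measurable_continuous_onI)
  have trans: "integrable lborel (\<lambda>x. F (x + c))" "(\<integral>x. F (x + c) \<partial>lborel) = (\<integral>x. F x \<partial>lborel)" for c
  proof -
    have "integrable (distr lborel borel (\<lambda>x. c + x)) F"
      using intF by (simp add: lborel_distr_plus)
    from integrable_distr[OF _ this]
    show "integrable lborel (\<lambda>x. F (x + c))" by (simp add: add.commute)
    have "(\<integral>x. F x \<partial>lborel) = (\<integral>x. F x \<partial>(distr lborel borel (\<lambda>x. c + x)))"
      by (simp add: lborel_distr_plus)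
    also have "\<dots> = (\<integral>x. F (c + x) \<partial>lborel)" by (rule integral_distr) auto
    finally show "(\<integral>x. F (x + c) \<partial>lborel) = (\<integral>x. F x \<partial>lborel)" by (simp add: add.commute)
  qed
  have q0: "(\<integral>x. q n x \<partial>lborel) = 0" for n
    unfolding q_def using intF trans by simp
  let ?R = "R + 2 * norm b"
  obtain B where B: "\<And>x. x \<in> cball 0 ?R \<Longrightarrow> \<bar>F' x b\<bar> \<le> B"
  proof -
    have "bounded ((\<lambda>x. F' x b) ` cball 0 ?R)"
      by (intro compact_imp_bounded compact_continuous_image continuous_on_subset[OF cont]) auto
    then obtain a where "\<forall>y\<in>(\<lambda>x. F' x b) ` cball 0 ?R. norm y \<le> a" unfolding bounded_iff by blast
    thus ?thesis using that[of a] by simp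
  qed
  have line: "((\<lambda>t. F (x + t *\<^sub>R b)) has_real_derivative F' (x + z *\<^sub>R b) b) (at z)" for x z
  proof -
    have "((\<lambda>t. x + t *\<^sub>R b) has_derivative (\<lambda>t. t *\<^sub>R b)) (at z)"
      by (auto intro!: derivative_eq_intros)
    from has_derivative_compose[OF this der] show ?thesis
      unfolding has_field_derivative_def
      using linear_scale[OF has_derivative_linear[OF der[of "x + z *\<^sub>R b"]]]
      by (simp add: mult_commute_abs)
  qed
  have lim: "(\<lambda>n. q n x) \<longlonglongrightarrow> F' x b" for x
  proof -
    have "((\<lambda>t. F (x + t *\<^sub>R b)) has_real_derivative F' x b) (at 0)"
      using line[of x 0] by simp
    hence "((\<lambda>t. (F (x + t *\<^sub>R b) - F x) / t) \<longlongrightarrow> F' x b) (at 0)"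
      by (simp add: has_field_derivative_iff)
    moreover have "filterlim h (at 0) sequentially"
      unfolding filterlim_at
    proof
      show "\<forall>\<^sub>F x in sequentially. h x \<in> UNIV \<and> h x \<noteq> 0"
        using h0 by (intro always_eventually allI) (metis UNIV_I less_irrefl)
      show "h \<longlonglongrightarrow> 0" unfolding h_def using LIMSEQ_inverse_real_of_nat by (simp add: inverse_eq_divide add.commute)
    qed
    ultimately show ?thesis unfolding q_def by (rule filterlim_compose)
  qed
  have bound: "\<bar>q n x\<bar> \<le> B * indicator (cball 0 (R + norm b)) x" for n x
  proof (cases "x \<in> cball 0 (R + norm b)")
    case True
    have "\<exists>z>0. z < h n \<and> F (x + h n *\<^sub>R b) - F (x + 0 *\<^sub>R b) = (h n - 0) * F' (x + z *\<^sub>R b) b"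
    proof (rule MVT2)
      show "0 < h n" by (rule h0)
      show "((\<lambda>t. F (x + t *\<^sub>R b)) has_real_derivative F' (x + z *\<^sub>R b) b) (at z)" for z
        by (rule line)
    qed
    then obtain z where z: "0 < z" "z < h n" "F (x + h n *\<^sub>R b) - F x = h n * F' (x + z *\<^sub>R b) b" by auto
    have "norm (x + z *\<^sub>R b) \<le> norm x + z * norm b"
      using norm_triangle_ineq[of x "z *\<^sub>R b"] z by simp
    also have "z * norm b \<le> 1 * norm b" using z h0[of n] by (intro mult_right_mono) auto
    finally have "x + z *\<^sub>R b \<in> cball 0 ?R" using True by auto
    from B[OF this] show ?thesis using z h0[of n] True by (auto simp: q_def)
  next
    case False
    hence "norm x > R + norm b" by auto
    moreover have "norm x \<le> norm (x + h n *\<^sub>R b) + h n * norm b"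
      using norm_triangle_ineq4[of "x + h n *\<^sub>R b" "h n *\<^sub>R b"] h0[of n] by simp
    moreover have "h n * norm b \<le> 1 * norm b" using h0[of n] by (intro mult_right_mono) auto
    ultimately have "norm x > R" "norm (x + h n *\<^sub>R b) > R" using norm_ge_zero[of b] by linarith+
    hence "x \<notin> K" "x + h n *\<^sub>R b \<notin> K" using R by auto
    thus ?thesis using False zero by (simp add: q_def)
  qed
  have "(\<lambda>n. \<integral>x. q n x \<partial>lborel) \<longlonglongrightarrow> (\<integral>x. F' x b \<partial>lborel)"
  proof (rule integral_dominated_convergence)
    show "(\<lambda>x. F' x b) \<in> borel_measurable lborel"
      using borel_measurable_continuous_onI[OF cont] by simp
    show "q n \<in> borel_measurable lborel" for n unfolding q_def by simp
    show "integrable lborel (\<lambda>x. B * indicator (cball 0 (R + norm b)) x)"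
      by (intro integrable_mult_right integrable_real_indicator) (auto intro!: emeasure_compact_finite simp flip: infinity_ennreal_def)
    show "AE x in lborel. (\<lambda>n. q n x) \<longlonglongrightarrow> F' x b" using lim by simp
    show "AE x in lborel. norm (q n x) \<le> B * indicator (cball 0 (R + norm b)) x" for n using bound by simp
  qed
  thus ?thesis using q0 by (simp add: LIMSEQ_const_iff)
qed

lemma integral_by_parts_compact_support:
  fixes f g :: "'a::euclidean_space \<Rightarrow> real"
  assumes f: "\<And>x. (f has_derivative f' x) (at x)" "continuous_on UNIV (\<lambda>x. f' x b)"
    and g: "\<And>x. (g has_derivative g' x) (at x)" "continuous_on UNIV (\<lambda>x. g' x b)"
    and K: "compact K" "\<And>x. x \<notin> K \<Longrightarrow> g x = 0"
  shows "(\<integral>x. f x * g' x b \<partial>lborel) = - (\<integral>x. f' x b * g x \<partial>lborel)"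
proof -
  have cf: "continuous_on UNIV f" and cg: "continuous_on UNIV g"
    using f g by (meson continuous_at_imp_continuous_on has_derivative_continuous)+
  have g'0: "g' x b = 0" if "x \<notin> K" for x
    using derivative_eq_0_outside[OF g(1) compact_imp_closed[OF K(1)] K(2) that] by simp
  have i1: "integrable lborel (\<lambda>x. f x * g' x b)"
    by (rule integrable_continuous_compact_support[OF _ K(1)])
       (auto intro!: continuous_intros cf g simp: g'0)
  have i2: "integrable lborel (\<lambda>x. f' x b * g x)"
    by (rule integrable_continuous_compact_support[OF _ K(1)])
       (auto intro!: continuous_intros cg f simp: K)
  have "(\<integral>x. f x * g' x b + f' x b * g x \<partial>lborel) = 0"
    by (rule integral_directional_derivative_eq_0[where F = "\<lambda>x. f x * g x"
          and F' = "\<lambda>x h. f x * g' x h + f' x h * g x" and b=b and K=K])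
       (auto intro!: has_derivative_mult f g continuous_intros cf cg simp: K)
  thus ?thesis using i1 i2 by simp
qed

lemma test_function_derivative:
  assumes "test_function \<psi>"
  shows "(\<psi> has_derivative frechet_derivative \<psi> (at x)) (at x)"
proof -
  have "continuously_differentiable (Suc 0) \<psi>" using assms unfolding test_function_def by blast
  thus ?thesis by (simp add: frechet_derivative_works[symmetric])
qed

lemma test_function_continuous_derivative:
  assumes "test_function \<psi>"
  shows "continuous_on UNIV (\<lambda>x. frechet_derivative \<psi> (at x) b)"
proof -
  have *: "continuously_differentiable (Suc 0) \<psi>" using assms unfolding test_function_def by blast
  have "continuous_on UNIV (\<lambda>x. \<Sum>e\<in>Basis. (b \<bullet> e) *\<^sub>R frechet_derivative \<psi> (at x) e)"
    using * by (intro continuous_intros) auto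
  moreover have "(\<Sum>e\<in>Basis. (b \<bullet> e) *\<^sub>R frechet_derivative \<psi> (at x) e) = frechet_derivative \<psi> (at x) b" for x
  proof -
    have L: "linear (frechet_derivative \<psi> (at x))"
      using test_function_derivative[OF assms] by (rule has_derivative_linear)
    have "frechet_derivative \<psi> (at x) (\<Sum>e\<in>Basis. (b \<bullet> e) *\<^sub>R e)
        = (\<Sum>e\<in>Basis. (b \<bullet> e) *\<^sub>R frechet_derivative \<psi> (at x) e)"
      by (simp add: linear_sum[OF L] linear_scale[OF L])
    thus ?thesis by (simp add: euclidean_representation)
  qed
  ultimately show ?thesis by simp
qed

lemma test_function_compact_support:
  assumes "test_function \<psi>"
  obtains K where "compact K" "\<And>x. x \<notin> K \<Longrightarrow> \<psi> x = 0"
proof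
  show "compact (closure {x. \<psi> x \<noteq> 0})" using assms by (simp add: test_function_def)
  show "\<psi> x = 0" if "x \<notin> closure {x. \<psi> x \<noteq> 0}" for x
    using that closure_subset[of "{x. \<psi> x \<noteq> 0}"] by blast
qed

lemma test_field_component:
  fixes \<phi> :: "real^'n \<Rightarrow> real^'m"
  assumes "test_function \<phi>"
  shows "((\<lambda>x. \<phi> x $ i) has_derivative (\<lambda>h. (jacobian_at \<phi> x *v h) $ i)) (at x)"
    and "continuous_on UNIV (\<lambda>x. jacobian_at \<phi> x $ i $ j)"
proof -
  have L: "linear (frechet_derivative \<phi> (at x))" for x
    using test_function_derivative[OF assms] by (rule has_derivative_linear)
  have J: "jacobian_at \<phi> x *v h = frechet_derivative \<phi> (at x) h" for x h
    unfolding jacobian_at_def by (rule matrix_works) (use L in \<open>simp add: linear_matrix_vector_mul_eq\<close>)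
  show "((\<lambda>x. \<phi> x $ i) has_derivative (\<lambda>h. (jacobian_at \<phi> x *v h) $ i)) (at x)"
    unfolding J
    by (rule bounded_linear.has_derivative[OF bounded_linear_vec_nth test_function_derivative[OF assms]])
  have "jacobian_at \<phi> x $ i $ j = frechet_derivative \<phi> (at x) (axis j 1) $ i" for x
    by (simp add: jacobian_at_def matrix_def)
  thus "continuous_on UNIV (\<lambda>x. jacobian_at \<phi> x $ i $ j)"
    by (simp add: continuous_on_component test_function_continuous_derivative[OF assms])
qed

section \<open>Derivatives of one-dimensional Gaussians\<close>

text \<open>\<open>gauss_deriv m P\<close> is the \<open>m\<close>-th derivative of the Gaussian of squared width \<open>P\<close>, given by the
  three-term recursion of the Hermite polynomials. The recursion is what turns a multiplication
  by \<open>x\<close> into derivatives of higher and lower order, which makes the Ornstein-Uhlenbeck operator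
  act on finite linear combinations.\<close>

fun gauss_deriv :: "nat \<Rightarrow> real \<Rightarrow> real \<Rightarrow> real" where
  "gauss_deriv 0 P x = exp (- x\<^sup>2 / P) / sqrt P"
| "gauss_deriv (Suc 0) P x = - (2 / P) * (x * gauss_deriv 0 P x)"
| "gauss_deriv (Suc (Suc m)) P x
     = - (2 / P) * (x * gauss_deriv (Suc m) P x + real (Suc m) * gauss_deriv m P x)"

lemma gauss_deriv_recursion:
  assumes "P > 0"
  shows "x * gauss_deriv (Suc m) P x
       = - (P / 2) * gauss_deriv (Suc (Suc m)) P x - real (Suc m) * gauss_deriv m P x"
  using assms by (simp add: field_simps del: gauss_deriv.simps(1,2))

lemma DERIV_gauss_deriv:
  assumes "P > 0"
  shows "(gauss_deriv m P has_real_derivative gauss_deriv (Suc m) P x) (at x)"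
  using assms
proof (induction m P x rule: gauss_deriv.induct)
  case (1 P x)
  thus ?case
    by (auto intro!: derivative_eq_intros simp: fun_eq_iff[symmetric] field_simps)
next
  case (2 P x)
  have e: "gauss_deriv (Suc 0) P = (\<lambda>x. - (2 / P) * (x * gauss_deriv 0 P x))" by auto
  have "((\<lambda>x. - (2 / P) * (x * gauss_deriv 0 P x)) has_real_derivative
      - (2 / P) * (1 * gauss_deriv 0 P x + gauss_deriv (Suc 0) P x * x)) (at x)"
    by (intro DERIV_cmult DERIV_mult DERIV_ident 2)
  thus ?case unfolding e by (rule DERIV_cong) (simp add: algebra_simps)
next
  case (3 m P x)
  have e: "gauss_deriv (Suc (Suc m)) P
      = (\<lambda>x. - (2 / P) * (x * gauss_deriv (Suc m) P x + real (Suc m) * gauss_deriv m P x))"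
    by auto
  have "((\<lambda>x. - (2 / P) * (x * gauss_deriv (Suc m) P x + real (Suc m) * gauss_deriv m P x))
     has_real_derivative - (2 / P) * (1 * gauss_deriv (Suc m) P x
         + gauss_deriv (Suc (Suc m)) P x * x + real (Suc m) * gauss_deriv (Suc m) P x)) (at x)"
    by (intro DERIV_cmult DERIV_add DERIV_mult DERIV_ident 3)
  thus ?case unfolding e by (rule DERIV_cong) (simp add: algebra_simps)
qed

text \<open>The heat equation, with \<open>P / 4\<close> as time.\<close>

lemma DERIV_gauss_deriv_width:
  assumes "P > 0"
  shows "((\<lambda>P. gauss_deriv m P x) has_real_derivative gauss_deriv (Suc (Suc m)) P x / 4) (at P)"
  using assms
proof (induction m P x rule: gauss_deriv.induct)
  case (1 P x)
  have "((\<lambda>P. exp (- x\<^sup>2 / P) / sqrt P) has_real_derivative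
      (exp (- x\<^sup>2 / P) * (x\<^sup>2 / P\<^sup>2) * sqrt P - exp (- x\<^sup>2 / P) * (inverse (sqrt P) / 2)) / (sqrt P * sqrt P)) (at P)"
    using 1 by (auto intro!: derivative_eq_intros simp: power2_eq_square)
  moreover have "(exp (- x\<^sup>2 / P) * (x\<^sup>2 / P\<^sup>2) * sqrt P - exp (- x\<^sup>2 / P) * (inverse (sqrt P) / 2)) / (sqrt P * sqrt P)
     = gauss_deriv (Suc (Suc 0)) P x / 4"
  proof -
    define s E where "s = sqrt P" and "E = exp (- x\<^sup>2 / P)"
    have "s > 0" "P = s * s" using 1 by (auto simp: s_def)
    thus ?thesis unfolding gauss_deriv.simps
      unfolding s_def[symmetric] E_def[symmetric]
      by (simp add: power2_eq_square field_simps)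
  qed
  ultimately show ?case by simp
next
  case (2 P x)
  have e: "(\<lambda>P. gauss_deriv (Suc 0) P x) = (\<lambda>P. (x * gauss_deriv 0 P x) * (- 2) / P)"
    by (simp add: fun_eq_iff ac_simps)
  have "((\<lambda>P. (x * gauss_deriv 0 P x) * (- 2) / P) has_real_derivative
      ((x * (gauss_deriv (Suc (Suc 0)) P x / 4)) * (- 2) * P - (x * gauss_deriv 0 P x) * (- 2) * 1) / (P * P)) (at P)"
    by (intro DERIV_divide DERIV_cmult_right DERIV_cmult DERIV_ident 2) (use 2 in auto)
  thus ?case unfolding e
    by (rule DERIV_cong) (use 2 in \<open>simp add: field_simps del: gauss_deriv.simps(1)\<close>)
next
  case (3 m P x)
  define A B C D where "A = gauss_deriv m P x" and "B = gauss_deriv (Suc m) P x"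
    and "C = gauss_deriv (Suc (Suc m)) P x" and "D = gauss_deriv (Suc (Suc (Suc m))) P x"
  have C: "C = - (2 / P) * (x * B + real (Suc m) * A)" by (simp add: A_def B_def C_def)
  have e: "(\<lambda>P. gauss_deriv (Suc (Suc m)) P x)
      = (\<lambda>P. (x * gauss_deriv (Suc m) P x + real (Suc m) * gauss_deriv m P x) * (- 2) / P)"
    by (simp add: fun_eq_iff algebra_simps add_divide_distrib diff_divide_distrib)
  have "((\<lambda>P. (x * gauss_deriv (Suc m) P x + real (Suc m) * gauss_deriv m P x) * (- 2) / P)
     has_real_derivative ((x * (D / 4) + real (Suc m) * (C / 4)) * (- 2) * P
        - (x * B + real (Suc m) * A) * (- 2) * 1) / (P * P)) (at P)"
    unfolding A_def B_def C_def D_def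
    by (intro DERIV_divide DERIV_add DERIV_cmult_right DERIV_cmult DERIV_ident 3) (use 3 in auto)
  moreover have "((x * (D / 4) + real (Suc m) * (C / 4)) * (- 2) * P
        - (x * B + real (Suc m) * A) * (- 2) * 1) / (P * P)
      = - (2 / P) * (x * D + real (Suc (Suc (Suc m))) * C) / 4"
  proof -
    have "x * B + real (Suc m) * A = - (P / 2) * C" using C 3 by (simp add: field_simps)
    thus ?thesis using 3 by (simp add: field_simps)
  qed
  ultimately show ?case unfolding e by (simp add: C_def D_def)
qed

lemma continuous_on_gauss_deriv [continuous_intros]:
  fixes f g :: "'a::topological_space \<Rightarrow> real"
  assumes "continuous_on S f" "continuous_on S g" "\<And>y. y \<in> S \<Longrightarrow> f y > 0"
  shows "continuous_on S (\<lambda>y. gauss_deriv m (f y) (g y))"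
proof -
  have nz: "\<forall>y\<in>S. f y \<noteq> 0" "\<forall>y\<in>S. sqrt (f y) \<noteq> 0" using assms(3) by (auto simp: less_le)
  have "continuous_on S (\<lambda>y. gauss_deriv m (f y) (g y)) \<and> continuous_on S (\<lambda>y. gauss_deriv (Suc m) (f y) (g y))"
    by (induction m) (auto intro!: continuous_intros assms simp: nz)
  thus ?thesis ..
qed

lemma abs_power_exp_minus_square_le:
  "\<exists>C\<ge>0. \<forall>y::real. \<bar>y\<bar> ^ k * exp (- y\<^sup>2) \<le> C"
proof (intro exI[of _ "1 + fact k"] conjI allI)
  fix y :: real
  \<comment> \<open>A single term of the exponential series controls the even power \<open>\<bar>y\<bar> ^ (2 * k)\<close>.\<close>
  have "(\<Sum>n\<in>{k}. (y\<^sup>2) ^ n /\<^sub>R fact n) \<le> (\<Sum>n. (y\<^sup>2) ^ n /\<^sub>R fact n)"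
    by (rule sum_le_suminf) (use summable_exp_generic[of "y\<^sup>2"] in auto)
  hence "(y\<^sup>2) ^ k \<le> fact k * exp (y\<^sup>2)"
    by (simp add: exp_def field_simps)
  hence "(\<bar>y\<bar> ^ k)\<^sup>2 \<le> fact k * exp (y\<^sup>2)"
    by (metis power2_abs power_commutes power_mult mult.commute)
  hence *: "(\<bar>y\<bar> ^ k)\<^sup>2 * exp (- y\<^sup>2) \<le> fact k"
    by (simp add: exp_minus divide_le_eq flip: divide_inverse)
  have "\<bar>y\<bar> ^ k \<le> 1 + (\<bar>y\<bar> ^ k)\<^sup>2"
    using zero_le_power2[of "\<bar>y\<bar> ^ k - 1 / 2"] by (simp add: power2_eq_square field_simps)
  hence "\<bar>y\<bar> ^ k * exp (- y\<^sup>2) \<le> (1 + (\<bar>y\<bar> ^ k)\<^sup>2) * exp (- y\<^sup>2)"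
    by (intro mult_right_mono) auto
  also have "\<dots> = exp (- y\<^sup>2) + (\<bar>y\<bar> ^ k)\<^sup>2 * exp (- y\<^sup>2)" by (simp add: algebra_simps)
  also have "\<dots> \<le> 1 + fact k" using * by (intro add_mono) auto
  finally show "\<bar>y\<bar> ^ k * exp (- y\<^sup>2) \<le> 1 + fact k" .
qed auto

text \<open>The powers of \<open>sqrt P\<close> are those dictated by scaling. Multiplying by \<open>x ^ k\<close> belongs to the
  induction hypothesis, because the recursion trades one derivative for one factor \<open>x\<close>.\<close>

lemma gauss_deriv_bound:
  "\<exists>C\<ge>0. \<forall>P>0. \<forall>x. \<bar>x\<bar> ^ k * \<bar>gauss_deriv m P x\<bar> \<le> C * sqrt P ^ k / sqrt P ^ Suc m"
proof (induction m arbitrary: k rule: less_induct)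
  case (less m)
  consider "m = 0" | "m = Suc 0" | n where "m = Suc (Suc n)" by (metis not0_implies_Suc)
  thus ?case
  proof cases
    case 1
    obtain C where C: "C \<ge> 0" "\<And>y::real. \<bar>y\<bar> ^ k * exp (- y\<^sup>2) \<le> C"
      using abs_power_exp_minus_square_le by blast
    show ?thesis
    proof (intro exI[of _ C] conjI allI impI)
      fix P x :: real assume P: "P > 0"
      have "\<bar>x / sqrt P\<bar> ^ k * exp (- (x / sqrt P)\<^sup>2) \<le> C" by (rule C)
      hence "\<bar>x\<bar> ^ k * exp (- x\<^sup>2 / P) \<le> C * sqrt P ^ k"
        using P by (simp add: power_divide field_simps)
      thus "\<bar>x\<bar> ^ k * \<bar>gauss_deriv m P x\<bar> \<le> C * sqrt P ^ k / sqrt P ^ Suc m"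
        using P 1 by (simp add: divide_right_mono)
    qed (use C in auto)
  next
    case 2
    obtain C where C: "C \<ge> 0" "\<And>P x. P > 0 \<Longrightarrow> \<bar>x\<bar> ^ Suc k * \<bar>gauss_deriv 0 P x\<bar> \<le> C * sqrt P ^ Suc k / sqrt P ^ Suc 0"
      using less[of 0 "Suc k"] 2 by blast
    show ?thesis
    proof (intro exI[of _ "2 * C"] conjI allI impI)
      fix P x :: real assume P: "P > 0"
      have "\<bar>x\<bar> ^ k * \<bar>gauss_deriv m P x\<bar> = 2 / P * (\<bar>x\<bar> ^ Suc k * \<bar>gauss_deriv 0 P x\<bar>)"
        using P 2 by (simp add: abs_mult)
      also have "\<dots> \<le> 2 / P * (C * sqrt P ^ Suc k / sqrt P ^ Suc 0)"
        using P C(2)[OF P, of x] by (intro mult_left_mono) auto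
      also have "\<dots> = 2 * C * sqrt P ^ k / sqrt P ^ Suc m"
        using P 2 by (simp add: field_simps)
      finally show "\<bar>x\<bar> ^ k * \<bar>gauss_deriv m P x\<bar> \<le> 2 * C * sqrt P ^ k / sqrt P ^ Suc m" .
    qed (use C in auto)
  next
    case 3
    obtain C where C: "C \<ge> 0" "\<And>P x. P > 0 \<Longrightarrow> \<bar>x\<bar> ^ Suc k * \<bar>gauss_deriv (Suc n) P x\<bar> \<le> C * sqrt P ^ Suc k / sqrt P ^ Suc (Suc n)"
      using less[of "Suc n" "Suc k"] 3 by blast
    obtain D where D: "D \<ge> 0" "\<And>P x. P > 0 \<Longrightarrow> \<bar>x\<bar> ^ k * \<bar>gauss_deriv n P x\<bar> \<le> D * sqrt P ^ k / sqrt P ^ Suc n"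
      using less[of n k] 3 by auto
    show ?thesis
    proof (intro exI[of _ "2 * C + 2 * real (Suc n) * D"] conjI allI impI)
      fix P x :: real assume P: "P > 0"
      have "\<bar>gauss_deriv m P x\<bar> = 2 / P * \<bar>x * gauss_deriv (Suc n) P x + real (Suc n) * gauss_deriv n P x\<bar>"
        using P 3 by (simp only: gauss_deriv.simps abs_mult) simp
      also have "\<dots> \<le> 2 / P * (\<bar>x\<bar> * \<bar>gauss_deriv (Suc n) P x\<bar> + real (Suc n) * \<bar>gauss_deriv n P x\<bar>)"
        using P abs_triangle_ineq[of "x * gauss_deriv (Suc n) P x" "real (Suc n) * gauss_deriv n P x"]
        by (intro mult_left_mono) (auto simp: abs_mult)
      finally have "\<bar>x\<bar> ^ k * \<bar>gauss_deriv m P x\<bar> \<le> \<bar>x\<bar> ^ k * (2 / P * (\<bar>x\<bar> * \<bar>gauss_deriv (Suc n) P x\<bar> + real (Suc n) * \<bar>gauss_deriv n P x\<bar>))"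
        by (intro mult_left_mono) auto
      also have "\<dots> = 2 / P * (\<bar>x\<bar> ^ Suc k * \<bar>gauss_deriv (Suc n) P x\<bar> + real (Suc n) * (\<bar>x\<bar> ^ k * \<bar>gauss_deriv n P x\<bar>))"
        by (simp add: algebra_simps)
      also have "\<dots> \<le> 2 / P * (C * sqrt P ^ Suc k / sqrt P ^ Suc (Suc n) + real (Suc n) * (D * sqrt P ^ k / sqrt P ^ Suc n))"
        using P C(2)[OF P, of x] D(2)[OF P, of x] by (intro mult_left_mono add_mono) auto
      also have "\<dots> = (2 * C + 2 * real (Suc n) * D) * sqrt P ^ k / sqrt P ^ Suc m"
      proof -
        define s where "s = sqrt P"
        have "s > 0" "P = s * s" using P by (auto simp: s_def)
        thus ?thesis unfolding s_def[symmetric] 3 by (simp add: field_simps)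
      qed
      finally show "\<bar>x\<bar> ^ k * \<bar>gauss_deriv m P x\<bar> \<le> (2 * C + 2 * real (Suc n) * D) * sqrt P ^ k / sqrt P ^ Suc m" .
    qed (use C D in auto)
  qed
qed

text \<open>Part of the Gaussian decay is exchanged for the fixed algebraic decay \<open>(1 + \<bar>x\<bar>) powr (- 3/4)\<close>, at
  the price \<open>P powr (3/8)\<close>. The exponent \<open>3/4\<close> is a compromise: it exceeds \<open>1/2\<close>, so that the bound is square integrable on
  the line, and stays below \<open>7/8\<close>, so that the decay in the widths that is left can still be
  integrated over the parameters \<open>r\<close> and \<open>t\<close> introduced below.\<close>

lemma gauss_deriv_decay:
  "\<exists>C\<ge>0. \<forall>P\<ge>1. \<forall>x. \<bar>gauss_deriv m P x\<bar> \<le> C * P powr (- 1/8 - real m / 2) * (1 + \<bar>x\<bar>) powr (- 3/4)"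
proof -
  obtain C where C: "C \<ge> 0" "\<And>P x. P > 0 \<Longrightarrow> \<bar>x\<bar> ^ 0 * \<bar>gauss_deriv m P x\<bar> \<le> C * sqrt P ^ 0 / sqrt P ^ Suc m"
    using gauss_deriv_bound[of 0 m] by auto
  obtain D where D: "D \<ge> 0" "\<And>P x. P > 0 \<Longrightarrow> \<bar>x\<bar> ^ 1 * \<bar>gauss_deriv m P x\<bar> \<le> D * sqrt P ^ 1 / sqrt P ^ Suc m"
    using gauss_deriv_bound[of 1 m] by auto
  show ?thesis
  proof (intro exI[of _ "C + D"] conjI allI impI)
    fix P x :: real assume P: "P \<ge> 1"
    define s where "s = sqrt P"
    have s: "s \<ge> 1" using P by (simp add: s_def)
    let ?g = "\<bar>gauss_deriv m P x\<bar>"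
    have le: "1 + \<bar>x\<bar> \<le> s * (1 + \<bar>x\<bar> / s)" using s by (simp add: field_simps)
    have "(1 + \<bar>x\<bar>) powr (3/4) \<le> (s * (1 + \<bar>x\<bar> / s)) powr (3/4)"
      by (intro powr_mono2 le) auto
    also have "\<dots> = s powr (3/4) * (1 + \<bar>x\<bar> / s) powr (3/4)"
      using s by (simp add: powr_mult)
    also have "\<dots> \<le> s powr (3/4) * (1 + \<bar>x\<bar> / s) powr 1"
      using s by (intro mult_left_mono powr_mono) auto
    finally have "?g * (1 + \<bar>x\<bar>) powr (3/4) \<le> ?g * (s powr (3/4) * (1 + \<bar>x\<bar> / s))"
      using s by (intro mult_left_mono) (auto simp: add_nonneg_nonneg)
    also have "\<dots> = s powr (3/4) * (?g + \<bar>x\<bar> * ?g / s)" by (simp add: algebra_simps)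
    also have "\<dots> \<le> s powr (3/4) * (C / s ^ Suc m + (D * s / s ^ Suc m) / s)"
      using C(2)[of P x] D(2)[of P x] P s unfolding s_def[symmetric]
      by (intro mult_left_mono add_mono divide_right_mono) auto
    also have "\<dots> = (C + D) * (s powr (3/4) / s ^ Suc m)" using s by (simp add: field_simps)
    also have "s powr (3/4) / s ^ Suc m = s powr (3/4 - real (Suc m))"
      using s by (subst powr_diff) (simp only: powr_realpow)
    also have "\<dots> = P powr (- 1/8 - real m / 2)"
      using P by (simp add: s_def powr_half_sqrt[symmetric] powr_powr field_simps)
    finally have "?g * (1 + \<bar>x\<bar>) powr (3/4) \<le> (C + D) * P powr (- 1/8 - real m / 2)" .
    moreover have "?g = ?g * (1 + \<bar>x\<bar>) powr (3/4) * (1 + \<bar>x\<bar>) powr (- 3/4)"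
    proof -
      have "(1 + \<bar>x\<bar>) powr (3/4) * (1 + \<bar>x\<bar>) powr (- 3/4) = 1"
        by (simp flip: powr_add)
      thus ?thesis by (simp add: mult.assoc)
    qed
    ultimately show "?g \<le> (C + D) * P powr (- 1/8 - real m / 2) * (1 + \<bar>x\<bar>) powr (- 3/4)"
      by (metis mult_right_mono powr_ge_zero)
  qed (use C D in auto)
qed

section \<open>Superpositions over a plane of parameters\<close>

lemma integrable_one_plus_abs_powr:
  fixes a :: real
  assumes "a > 1"
  shows "integrable lborel (\<lambda>x::real. (1 + \<bar>x\<bar>) powr (- a))"
proof -
  let ?g = "\<lambda>x::real. (1 + x) powr (- a) * indicator {0..} x"
  have "(\<integral>\<^sup>+x. ennreal ((1 + \<bar>x\<bar>) powr (- a)) * indicator {0..} x \<partial>lborel)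
      = ennreal (0 - (1 + 0) powr (1 - a) / (1 - a))"
  proof (rule nn_integral_FTC_atLeast)
    show "((\<lambda>x. (1 + x) powr (1 - a) / (1 - a)) has_real_derivative (1 + \<bar>x\<bar>) powr (- a)) (at x)" if "0 \<le> x" for x :: real
    proof -
      have "((\<lambda>x. (1 + x) powr (1 - a)) has_real_derivative
          (1 - a) * (1 + x) powr (1 - a - of_nat 1) * 1) (at x)"
        using that by (intro DERIV_fun_powr) (auto intro!: derivative_eq_intros)
      from DERIV_cdivide[OF this, of "1 - a"] show ?thesis using that assms by simp
    qed
    have "((\<lambda>x::real. (1 + x) powr (1 - a)) \<longlongrightarrow> 0) at_top"
      using assms by real_asymp
    thus "((\<lambda>x::real. (1 + x) powr (1 - a) / (1 - a)) \<longlongrightarrow> 0) at_top"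
      using tendsto_divide_zero by blast
  qed auto
  hence fin: "(\<integral>\<^sup>+x. ennreal ((1 + \<bar>x\<bar>) powr (- a)) * indicator {0..} x \<partial>lborel) < \<infinity>" by simp
  have "integrable lborel ?g"
  proof (rule integrableI_bounded)
    have "(\<integral>\<^sup>+x. ennreal (norm (?g x)) \<partial>lborel) = (\<integral>\<^sup>+x. ennreal ((1 + \<bar>x\<bar>) powr (- a)) * indicator {0..} x \<partial>lborel)"
      by (intro nn_integral_cong) (auto simp: indicator_def)
    thus "(\<integral>\<^sup>+x. ennreal (norm (?g x)) \<partial>lborel) < \<infinity>" using fin by simp
  qed simp
  moreover from this have "integrable lborel (\<lambda>x. ?g (0 + (-1) * x))"
    by (rule lborel_integrable_real_affine) simp
  ultimately have "integrable lborel (\<lambda>x. ?g x + ?g (0 + (-1) * x))" by (rule Bochner_Integration.integrable_add)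
  thus ?thesis
    by (rule Bochner_Integration.integrable_bound) (auto intro!: AE_I2 simp: indicator_def)
qed

text \<open>All families that are integrated below depend on a parameter \<open>y = (r, t)\<close> and a point \<open>x\<close>, and are
  bounded by a multiple of \<open>weight y * envelope x\<close>. The weight is integrable and the envelope
  square integrable, so that averages over \<open>y\<close> lie in \<open>L2\<close> without any use of the Fourier
  transform.\<close>

definition envelope :: "real^'n \<Rightarrow> real" where
  "envelope x = (\<Prod>i\<in>UNIV. (1 + \<bar>x $ i\<bar>) powr (- 3/4))"

definition weight :: "real \<times> real \<Rightarrow> real" where
  "weight y = (1 + \<bar>fst y\<bar>) powr (- 2) * (1 + \<bar>snd y\<bar>) powr (- 5/4)"

lemma weight_nonneg: "weight y \<ge> 0" by (simp add: weight_def)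

lemma envelope_nonneg: "envelope x \<ge> 0" by (simp add: envelope_def prod_nonneg)

lemma continuous_on_envelope: "continuous_on UNIV envelope"
  unfolding envelope_def by (intro continuous_intros) (auto simp: add_nonneg_eq_0_iff)

lemma integrable_weight: "integrable lborel weight"
proof -
  let ?f = "\<lambda>r::real. (1 + \<bar>r\<bar>) powr (- 2)" and ?g = "\<lambda>t::real. (1 + \<bar>t\<bar>) powr (- (5/4))"
  have f: "integrable lborel ?f" and g: "integrable lborel ?g"
    by (rule integrable_one_plus_abs_powr, simp)+
  have "integrable (lborel \<Otimes>\<^sub>M lborel) (\<lambda>y. ?f (fst y) * ?g (snd y))"
    by (rule lborel_pair.Fubini_integrable) (use f g in \<open>auto simp: abs_mult\<close>)
  thus ?thesis by (simp add: lborel_prod weight_def[abs_def])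
qed

lemma integrable_envelope_square: "integrable lborel (\<lambda>x::real^'n. (envelope x)\<^sup>2)"
proof -
  let ?f = "\<lambda>x::real. (1 + \<bar>x\<bar>) powr (- (3/2))"
  have f: "integrable lborel ?f" by (rule integrable_one_plus_abs_powr) simp
  have sq: "(envelope x)\<^sup>2 = (\<Prod>b\<in>Basis. ?f (x \<bullet> b))" for x :: "real^'n"
  proof -
    have "(\<Prod>b\<in>Basis. ?f (x \<bullet> b)) = (\<Prod>i\<in>UNIV. ?f (x $ i))"
      unfolding Basis_vec_def
      by (subst prod.reindex_cong[where l="\<lambda>i. axis i 1" and B=UNIV]) 
         (auto simp: inj_on_def axis_eq_axis inner_axis)
    also have "\<dots> = (\<Prod>i\<in>UNIV. ((1 + \<bar>x $ i\<bar>) powr (- 3/4))\<^sup>2)"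
      by (intro prod.cong) (auto simp: power2_eq_square simp flip: powr_add)
    finally show ?thesis by (simp add: envelope_def prod_power_distrib)
  qed
  show ?thesis
  proof (rule integrableI_bounded)
    show "(\<lambda>x::real^'n. (envelope x)\<^sup>2) \<in> borel_measurable lborel"
      using continuous_on_envelope by (auto intro!: borel_measurable_continuous_onI continuous_intros)
    have "(\<integral>\<^sup>+x. ennreal (norm ((envelope (x::real^'n))\<^sup>2)) \<partial>lborel)
        = (\<integral>\<^sup>+x. (\<Prod>b\<in>Basis. ennreal (?f (x \<bullet> b))) \<partial>(lborel :: (real^'n) measure))"
      unfolding sq by (intro nn_integral_cong) (auto simp: prod_ennreal abs_prod)
    also have "\<dots> = (\<Prod>b\<in>(Basis::(real^'n) set). (\<integral>\<^sup>+x. ennreal (?f x) \<partial>lborel))"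
      by (rule nn_integral_lborel_prod) auto
    also have "\<dots> < \<infinity>"
      using f by (auto simp: integrable_iff_bounded less_top[symmetric] ennreal_prod_eq_top power_eq_top_ennreal)
    finally show "(\<integral>\<^sup>+x. ennreal (norm ((envelope (x::real^'n))\<^sup>2)) \<partial>lborel) < \<infinity>" .
  qed
qed

definition superposable :: "(real \<times> real \<Rightarrow> real^3 \<Rightarrow> real) \<Rightarrow> bool" where
  "superposable F \<longleftrightarrow> continuous_on UNIV (\<lambda>z. F (fst z) (snd z)) \<and>
     (\<exists>C\<ge>0. \<forall>y x. \<bar>F y x\<bar> \<le> C * weight y * envelope x)"

definition superposition :: "(real \<times> real \<Rightarrow> real^3 \<Rightarrow> real) \<Rightarrow> real^3 \<Rightarrow> real" where
  "superposition F x = (\<integral>y. F y x \<partial>lborel)"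

lemma superposable_add:
  assumes "superposable F" "superposable G"
  shows "superposable (\<lambda>y x. F y x + G y x)"
proof -
  obtain C where C: "C \<ge> 0" "\<And>y x. \<bar>F y x\<bar> \<le> C * weight y * envelope x" using assms(1) superposable_def by auto
  obtain D where D: "D \<ge> 0" "\<And>y x. \<bar>G y x\<bar> \<le> D * weight y * envelope x" using assms(2) superposable_def by auto
  have "\<bar>F y x + G y x\<bar> \<le> (C + D) * weight y * envelope x" for y x
    using abs_triangle_ineq[of "F y x" "G y x"] C(2)[of y x] D(2)[of y x] by (simp add: algebra_simps)
  thus ?thesis using assms C D unfolding superposable_def
    by (intro conjI exI[of _ "C + D"]) (auto intro!: continuous_intros)
qed

lemma superposable_cmult:
  assumes "superposable F"
  shows "superposable (\<lambda>y x. c * F y x)"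
proof -
  obtain C where C: "C \<ge> 0" "\<And>y x. \<bar>F y x\<bar> \<le> C * weight y * envelope x" using assms(1) superposable_def by auto
  have "\<bar>c * F y x\<bar> \<le> (\<bar>c\<bar> * C) * weight y * envelope x" for y x
    using C(2)[of y x] mult_left_mono[of "\<bar>F y x\<bar>" _ "\<bar>c\<bar>"] by (simp add: abs_mult mult.assoc)
  thus ?thesis using assms C unfolding superposable_def
    by (intro conjI exI[of _ "\<bar>c\<bar> * C"]) (auto intro!: continuous_intros)
qed

lemma superposable_uminus: "superposable F \<Longrightarrow> superposable (\<lambda>y x. - F y x)"
  using superposable_cmult[of F "-1"] by simp

lemma superposable_diff: "superposable F \<Longrightarrow> superposable G \<Longrightarrow> superposable (\<lambda>y x. F y x - G y x)"
  using superposable_add[of F "\<lambda>y x. - G y x"] superposable_uminus[of G] by simp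

lemma superposable_continuous_slices:
  assumes "superposable F"
  shows "continuous_on UNIV (\<lambda>x. F y x)" "continuous_on UNIV (\<lambda>y. F y x)"
proof -
  have c: "continuous_on UNIV (\<lambda>z. F (fst z) (snd z))" using assms by (simp add: superposable_def)
  show "continuous_on UNIV (\<lambda>x. F y x)"
    using continuous_on_compose2[OF c, of UNIV "\<lambda>x. (y, x)"]
    by (simp add: continuous_on_Pair continuous_on_const continuous_on_id)
  show "continuous_on UNIV (\<lambda>y. F y x)"
    using continuous_on_compose2[OF c, of UNIV "\<lambda>y. (y, x)"]
    by (simp add: continuous_on_Pair continuous_on_const continuous_on_id)
qed

lemma superposable_integrable:
  assumes "superposable F"
  shows "integrable lborel (\<lambda>y. F y x)"
proof -
  obtain C where C: "C \<ge> 0" "\<And>y x. \<bar>F y x\<bar> \<le> C * weight y * envelope x" using assms(1) superposable_def by auto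
  have "integrable lborel (\<lambda>y. C * weight y * envelope x)"
    using integrable_weight by simp
  thus ?thesis
  proof (rule Bochner_Integration.integrable_bound)
    show "(\<lambda>y. F y x) \<in> borel_measurable lborel"
      using borel_measurable_continuous_onI[OF superposable_continuous_slices(2)[OF assms]] by simp
    show "AE y in lborel. norm (F y x) \<le> norm (C * weight y * envelope x)"
      using C order_trans[OF C(2) abs_ge_self] by auto
  qed
qed

lemma superposition_bound:
  assumes "superposable F"
  obtains C where "C \<ge> 0" "\<And>x. \<bar>superposition F x\<bar> \<le> C * envelope x"
proof -
  obtain C where C: "C \<ge> 0" "\<And>y x. \<bar>F y x\<bar> \<le> C * weight y * envelope x" using assms(1) superposable_def by auto
  have "\<bar>superposition F x\<bar> \<le> (C * (\<integral>y. weight y \<partial>lborel)) * envelope x" for x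
  proof -
    have "\<bar>superposition F x\<bar> \<le> (\<integral>y. C * weight y * envelope x \<partial>lborel)"
      unfolding superposition_def
      by (rule integral_abs_bound[THEN order_trans], rule integral_mono)
         (use C integrable_weight superposable_integrable[OF assms] in auto)
    thus ?thesis by simp
  qed
  moreover have "C * (\<integral>y. weight y \<partial>lborel) \<ge> 0"
    using C by (auto intro!: mult_nonneg_nonneg integral_nonneg_AE simp: weight_nonneg)
  ultimately show ?thesis using that by blast
qed

lemma superposable_measurable:
  assumes "superposable F"
  shows "(\<lambda>(y, x). F y x) \<in> borel_measurable (lborel \<Otimes>\<^sub>M lborel)"
proof -
  have "(\<lambda>(y, x). F y x) = (\<lambda>z. F (fst z) (snd z))" by auto
  thus ?thesis using assms borel_measurable_continuous_onI
    by (auto simp: superposable_def lborel_prod)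
qed

lemma superposition_measurable [measurable]:
  assumes "superposable F"
  shows "superposition F \<in> borel_measurable borel"
proof -
  have "(\<lambda>(x, y). F y x) \<in> borel_measurable (lborel \<Otimes>\<^sub>M lborel)"
    using measurable_pair_swap[OF superposable_measurable[OF assms]] by (simp add: case_prod_unfold)
  from lborel.borel_measurable_lebesgue_integral[OF this]
  show ?thesis by (simp add: superposition_def[abs_def])
qed

text \<open>The bound by a product of an integrable function of the parameter and a function of
  space is what makes Fubini's theorem applicable.\<close>

lemma superposition_Fubini:
  assumes F: "superposable F" and c: "continuous_on UNIV c" and K: "compact K" "\<And>x. x \<notin> K \<Longrightarrow> c x = 0"
  shows "integrable lborel (\<lambda>x. c x * superposition F x)"
    and "integrable lborel (\<lambda>x. c x * F y x)"
    and "integrable lborel (\<lambda>y. \<integral>x. c x * F y x \<partial>lborel)"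
    and "(\<integral>x. c x * superposition F x \<partial>lborel) = (\<integral>y. (\<integral>x. c x * F y x \<partial>lborel) \<partial>lborel)"
proof -
  obtain C where C: "C \<ge> 0" "\<And>y x. \<bar>F y x\<bar> \<le> C * weight y * envelope x" using F superposable_def by auto
  have [measurable]: "c \<in> borel_measurable borel" using c by (rule borel_measurable_continuous_onI)
  have slice: "integrable lborel (\<lambda>x. c x * F y x)" for y
    by (rule integrable_continuous_compact_support[OF _ K(1)])
       (auto intro!: continuous_intros c superposable_continuous_slices[OF F] simp: K)
  have e: "integrable lborel (\<lambda>x. \<bar>c x\<bar> * envelope x)"
    by (rule integrable_continuous_compact_support[OF _ K(1)])
       (auto intro!: continuous_intros c continuous_on_envelope simp: K)
  have m: "(\<lambda>(y, x). c x * F y x) \<in> borel_measurable (lborel \<Otimes>\<^sub>M lborel)"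
    using superposable_measurable[OF F] by (simp add: case_prod_unfold)
  have joint: "integrable (lborel \<Otimes>\<^sub>M lborel) (\<lambda>(y, x). c x * F y x)"
  proof (rule lborel_pair.Fubini_integrable[OF m])
    show "AE y in lborel. integrable lborel (\<lambda>x. case (y, x) of (y, x) \<Rightarrow> c x * F y x)"
      using slice by simp
    have "integrable lborel (\<lambda>y. C * weight y * (\<integral>x. \<bar>c x\<bar> * envelope x \<partial>lborel))"
      using integrable_weight by simp
    thus "integrable lborel (\<lambda>y. \<integral>x. norm (case (y, x) of (y, x) \<Rightarrow> c x * F y x) \<partial>lborel)"
    proof (rule Bochner_Integration.integrable_bound)
      show "(\<lambda>y. \<integral>x. norm (case (y, x) of (y, x) \<Rightarrow> c x * F y x) \<partial>lborel) \<in> borel_measurable lborel"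
        using m by measurable
      have "(\<integral>x. \<bar>c x * F y x\<bar> \<partial>lborel) \<le> C * weight y * (\<integral>x. \<bar>c x\<bar> * envelope x \<partial>lborel)" for y
      proof -
        have "(\<integral>x. \<bar>c x * F y x\<bar> \<partial>lborel) \<le> (\<integral>x. C * weight y * (\<bar>c x\<bar> * envelope x) \<partial>lborel)"
        proof (rule integral_mono)
          show "integrable lborel (\<lambda>x. \<bar>c x * F y x\<bar>)" using slice by simp
          show "integrable lborel (\<lambda>x. C * weight y * (\<bar>c x\<bar> * envelope x))" using e by simp
          show "\<bar>c x * F y x\<bar> \<le> C * weight y * (\<bar>c x\<bar> * envelope x)" for x
            using mult_left_mono[OF C(2)[of y x], of "\<bar>c x\<bar>"] by (simp add: abs_mult mult_ac)
        qed
        thus ?thesis by simp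
      qed
      thus "AE y in lborel. norm (\<integral>x. norm (case (y, x) of (y, x) \<Rightarrow> c x * F y x) \<partial>lborel)
              \<le> norm (C * weight y * (\<integral>x. \<bar>c x\<bar> * envelope x \<partial>lborel))"
        by (intro AE_I2) (auto intro: order_trans[OF _ abs_ge_self])
    qed
  qed
  show "integrable lborel (\<lambda>x. c x * F y x)" by (rule slice)
  show "integrable lborel (\<lambda>y. \<integral>x. c x * F y x \<partial>lborel)"
    using lborel_pair.integrable_fst[OF joint] by simp
  show "integrable lborel (\<lambda>x. c x * superposition F x)"
    using lborel_pair.integrable_snd[OF joint] by (simp add: superposition_def)
  show "(\<integral>x. c x * superposition F x \<partial>lborel) = (\<integral>y. (\<integral>x. c x * F y x \<partial>lborel) \<partial>lborel)"
    using lborel_pair.Fubini_integral[OF joint] by (simp add: superposition_def)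
qed

section \<open>Gaussian modes in three dimensions\<close>

text \<open>The Gaussian with squared widths \<open>40\<close> (horizontal) and \<open>10/7\<close> (vertical) is the equilibrium of
  the Ornstein-Uhlenbeck operator with contraction rates \<open>1/20, 1/20, 7/5\<close> below: these widths are
  \<open>2 / rate\<close>. The parameter \<open>\<bar>t\<bar>\<close> is a heat flow time (up to a factor 4), and integrating over it
  inverts the Laplacian. The parameter \<open>r ^ 16\<close> widens the Gaussian vertically only: integrating
  over \<open>r\<close> multiplies the Fourier transform by \<open>\<bar>k\<^sub>3\<bar> powr (- 1/8)\<close>, since
  \<open>exp (- r ^ 16 * k\<^sub>3\<^sup>2 / 4)\<close> depends on \<open>r * \<bar>k\<^sub>3\<bar> powr (1/8)\<close> alone. Absolute values and an even power are used
  so that both parameters may range over the whole line.\<close>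

definition width_h :: "real \<times> real \<Rightarrow> real" where "width_h y = 40 + \<bar>snd y\<bar>"
definition width_v :: "real \<times> real \<Rightarrow> real" where "width_v y = 10/7 + fst y ^ 16 + \<bar>snd y\<bar>"

definition gauss3 :: "nat \<Rightarrow> nat \<Rightarrow> nat \<Rightarrow> real \<Rightarrow> real \<Rightarrow> real^3 \<Rightarrow> real" where
  "gauss3 a b c P Q x = gauss_deriv a P (x $ 1) * gauss_deriv b P (x $ 2) * gauss_deriv c Q (x $ 3)"

definition mode :: "nat \<Rightarrow> nat \<Rightarrow> nat \<Rightarrow> real \<times> real \<Rightarrow> real^3 \<Rightarrow> real" where
  "mode a b c y = gauss3 a b c (width_h y) (width_v y)"

lemma width_h_ge: "width_h y \<ge> 1 + \<bar>snd y\<bar>" "width_h y \<ge> 1" "width_h y > 0"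
  by (auto simp: width_h_def)

lemma even_power_16_nonneg: "(r::real) ^ 16 \<ge> 0" by (rule zero_le_even_power) simp

lemma width_v_ge: "width_v y \<ge> 1" "width_v y > 0" "28 * width_v y \<ge> width_h y"
proof -
  note nn = even_power_16_nonneg[of "fst y"] abs_ge_zero[of "snd y"]
  show "width_v y \<ge> 1" "width_v y > 0" unfolding width_v_def using nn by linarith+
  have "28 * width_v y = 40 + 28 * fst y ^ 16 + 28 * \<bar>snd y\<bar>" by (simp add: width_v_def)
  thus "28 * width_v y \<ge> width_h y" unfolding width_h_def using nn by linarith
qed

text \<open>This is the only source of decay in \<open>r\<close>. An exponent \<open>n\<close> in place of 16 would give
  \<open>(1 + \<bar>r\<bar>) powr (- n/8)\<close> here and the eigenvalue \<open>1/10 - 14/(5 n)\<close> below, so it has to lie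
  strictly between 8 and 28.\<close>

lemma width_v_powr_le: "width_v y powr (- 1/8) \<le> 4 * (1 + \<bar>fst y\<bar>) powr (- 2)"
proof -
  define s where "s = (1 + \<bar>fst y\<bar>) / 2"
  have s: "s > 0" by (auto simp: s_def add_pos_nonneg)
  \<comment> \<open>\<open>s\<close> is the mean of \<open>1\<close> and \<open>\<bar>r\<bar>\<close>, hence at most their maximum.\<close>
  have "s ^ 16 \<le> width_v y"
  proof (cases "\<bar>fst y\<bar> \<le> 1")
    case True
    hence "s ^ 16 \<le> 1 ^ 16" using s by (intro power_mono) (auto simp: s_def)
    thus ?thesis using width_v_ge(1)[of y] by simp
  next
    case False
    hence "s ^ 16 \<le> \<bar>fst y\<bar> ^ 16" using s by (intro power_mono) (auto simp: s_def)
    thus ?thesis by (simp add: width_v_def power_even_abs)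
  qed
  hence "width_v y powr (- 1/8) \<le> (s ^ 16) powr (- 1/8)"
    using s by (intro powr_mono2') auto
  also have "(s ^ 16) powr (- 1/8) = s powr (- 2)"
  proof -
    have "s ^ 16 = s powr 16" using s by simp
    thus ?thesis by (simp only: powr_powr) simp
  qed
  also have "\<dots> = 4 * (1 + \<bar>fst y\<bar>) powr (- 2)"
    by (simp add: s_def powr_divide powr_minus powr_numeral field_simps)
  finally show ?thesis .
qed

lemma envelope_3: "envelope (x::real^3)
    = (1 + \<bar>x $ 1\<bar>) powr (- 3/4) * (1 + \<bar>x $ 2\<bar>) powr (- 3/4) * (1 + \<bar>x $ 3\<bar>) powr (- 3/4)"
  unfolding envelope_def UNIV_3 by (simp add: mult.assoc)

lemma mode_decay:
  "\<exists>C\<ge>0. \<forall>y x. width_h y ^ i * width_v y ^ j * \<bar>mode a b c y x\<bar>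
     \<le> C * width_h y powr (- 1/4 - (real (a + b) / 2 - real i))
         * width_v y powr (- 1/8 - (real c / 2 - real j)) * envelope x"
proof -
  obtain A where "A \<ge> 0 \<and> (\<forall>P\<ge>1. \<forall>x. \<bar>gauss_deriv a P x\<bar> \<le> A * P powr (- 1/8 - real a / 2) * (1 + \<bar>x\<bar>) powr (- 3/4))"
    using gauss_deriv_decay[of a] by (rule exE)
  note A = conjunct1[OF this] conjunct2[OF this, rule_format]
  obtain B where "B \<ge> 0 \<and> (\<forall>P\<ge>1. \<forall>x. \<bar>gauss_deriv b P x\<bar> \<le> B * P powr (- 1/8 - real b / 2) * (1 + \<bar>x\<bar>) powr (- 3/4))"
    using gauss_deriv_decay[of b] by (rule exE)
  note B = conjunct1[OF this] conjunct2[OF this, rule_format]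
  obtain C where "C \<ge> 0 \<and> (\<forall>P\<ge>1. \<forall>x. \<bar>gauss_deriv c P x\<bar> \<le> C * P powr (- 1/8 - real c / 2) * (1 + \<bar>x\<bar>) powr (- 3/4))"
    using gauss_deriv_decay[of c] by (rule exE)
  note C = conjunct1[OF this] conjunct2[OF this, rule_format]
  show ?thesis
  proof (intro exI[of _ "A * B * C"] conjI allI)
    fix y and x :: "real^3"
    define P Q where "P = width_h y" and "Q = width_v y"
    have PQ: "P \<ge> 1" "Q \<ge> 1" using width_h_ge width_v_ge by (auto simp: P_def Q_def)
    define X where "X = (\<lambda>k. (1 + \<bar>x $ k\<bar>) powr (- 3/4))"
    define p1 p2 q1 where "p1 = P powr (- 1/8 - real a / 2)" and "p2 = P powr (- 1/8 - real b / 2)"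
      and "q1 = Q powr (- 1/8 - real c / 2)"
    have nn: "p1 \<ge> 0" "p2 \<ge> 0" "q1 \<ge> 0" "X k \<ge> 0" for k by (simp_all add: p1_def p2_def q1_def X_def)
    have "\<bar>mode a b c y x\<bar> = \<bar>gauss_deriv a P (x $ 1)\<bar> * \<bar>gauss_deriv b P (x $ 2)\<bar> * \<bar>gauss_deriv c Q (x $ 3)\<bar>"
      by (simp add: mode_def gauss3_def abs_mult P_def Q_def)
    also have "\<dots> \<le> (A * p1 * X 1) * (B * p2 * X 2) * (C * q1 * X 3)"
      unfolding p1_def p2_def q1_def X_def
      by (intro mult_mono A B C PQ mult_nonneg_nonneg abs_ge_zero powr_ge_zero)
    finally have "P ^ i * Q ^ j * \<bar>mode a b c y x\<bar> \<le> P ^ i * Q ^ j * ((A * p1 * X 1) * (B * p2 * X 2) * (C * q1 * X 3))"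
      using PQ by (intro mult_left_mono) simp_all
    also have "\<dots> = A * B * C * (P ^ i * (p1 * p2)) * (Q ^ j * q1) * (X 1 * X 2 * X 3)"
      by (simp only: mult_ac)
    also have "P ^ i * (p1 * p2) = P powr (- 1/4 - (real (a + b) / 2 - real i))"
    proof -
      have "P ^ i = P powr real i" using PQ by (simp add: powr_realpow)
      moreover have "real i + ((- 1/8 - real a / 2) + (- 1/8 - real b / 2)) = - 1/4 - (real (a + b) / 2 - real i)"
        by (simp add: field_simps)
      ultimately show ?thesis by (simp only: p1_def p2_def powr_add[symmetric])
    qed
    also have "Q ^ j * q1 = Q powr (- 1/8 - (real c / 2 - real j))"
    proof -
      have "Q ^ j = Q powr real j" using PQ by (simp add: powr_realpow)
      moreover have "real j + (- 1/8 - real c / 2) = - 1/8 - (real c / 2 - real j)"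
        by simp
      ultimately show ?thesis by (simp only: q1_def powr_add[symmetric])
    qed
    also have "X 1 * X 2 * X 3 = envelope x" by (simp only: X_def envelope_3)
    finally show "width_h y ^ i * width_v y ^ j * \<bar>mode a b c y x\<bar>
     \<le> A * B * C * width_h y powr (- 1/4 - (real (a + b) / 2 - real i))
         * width_v y powr (- 1/8 - (real c / 2 - real j)) * envelope x"
      by (simp only: P_def Q_def)
  qed (intro mult_nonneg_nonneg A(1) B(1) C(1))
qed

lemma mode_decay_coarse:
  assumes "2 * i \<le> a + b" "2 * j \<le> c"
  shows "\<exists>C\<ge>0. \<forall>y x. width_h y ^ i * width_v y ^ j * \<bar>mode a b c y x\<bar>
     \<le> C * width_h y powr (- 1/4) * width_v y powr (- 1/8) * envelope x"
proof -
  obtain C where "C \<ge> 0 \<and> (\<forall>y x. width_h y ^ i * width_v y ^ j * \<bar>mode a b c y x\<bar>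
     \<le> C * width_h y powr (- 1/4 - (real (a + b) / 2 - real i))
         * width_v y powr (- 1/8 - (real c / 2 - real j)) * envelope x)"
    using mode_decay[of i j a b c] by (rule exE)
  note C = conjunct1[OF this] conjunct2[OF this, rule_format]
  have "real (2 * i) \<le> real (a + b)" "real (2 * j) \<le> real c"
    using assms by (simp_all only: of_nat_le_iff)
  hence ij: "real i \<le> real (a + b) / 2" "real j \<le> real c / 2" by simp_all
  show ?thesis
  proof (intro exI[of _ C] conjI allI order_trans[OF C(2)])
    fix y and x :: "real^3"
    show "C * width_h y powr (- 1/4 - (real (a + b) / 2 - real i))
         * width_v y powr (- 1/8 - (real c / 2 - real j)) * envelope x
       \<le> C * width_h y powr (- 1/4) * width_v y powr (- 1/8) * envelope x"
      using C(1) ij width_h_ge(2)[of y] width_v_ge(1)[of y] envelope_nonneg[of x]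
      by (intro mult_mono powr_mono mult_nonneg_nonneg) auto
  qed (rule C(1))
qed

text \<open>Because \<open>width_h\<close> is at most a multiple of \<open>width_v\<close>, spare decay in the vertical width counts as
  decay in \<open>t\<close>. The hypothesis says that after paying for the factors \<open>width_h ^ i\<close> and
  \<open>width_v ^ j\<close> with two derivatives each, two derivatives are left, which is exactly what
  lifts the decay \<open>P powr (- 1/4)\<close> of the undifferentiated mode to the integrable \<open>P powr (- 5/4)\<close>.\<close>

lemma mode_superposable_bound:
  assumes "2 * i \<le> a + b" "2 * j \<le> c" "2 + 2 * i + 2 * j \<le> a + b + c"
  shows "\<exists>C\<ge>0. \<forall>y x. width_h y ^ i * width_v y ^ j * \<bar>mode a b c y x\<bar> \<le> C * weight y * envelope x"
proof -
  obtain C where "C \<ge> 0 \<and> (\<forall>y x. width_h y ^ i * width_v y ^ j * \<bar>mode a b c y x\<bar>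
     \<le> C * width_h y powr (- 1/4 - (real (a + b) / 2 - real i))
         * width_v y powr (- 1/8 - (real c / 2 - real j)) * envelope x)"
    using mode_decay[of i j a b c] by (rule exE)
  note C = conjunct1[OF this] conjunct2[OF this, rule_format]
  define \<alpha> \<gamma> where "\<alpha> = real (a + b) / 2 - real i" and "\<gamma> = real c / 2 - real j"
  have "real (2 * i) \<le> real (a + b)" "real (2 * j) \<le> real c" "real (2 + 2 * i + 2 * j) \<le> real (a + b + c)"
    using assms by (simp_all only: of_nat_le_iff)
  hence ag: "\<alpha> \<ge> 0" "\<gamma> \<ge> 0" "\<alpha> + \<gamma> \<ge> 1" by (simp_all add: \<alpha>_def \<gamma>_def field_simps)
  show ?thesis
  proof (intro exI[of _ "C * (28 powr \<gamma> * 4)"] conjI allI)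
    fix y and x :: "real^3"
    define P Q where "P = width_h y" and "Q = width_v y"
    have PQ: "P \<ge> 1" "Q \<ge> 1" "28 * Q \<ge> P" "P \<ge> 1 + \<bar>snd y\<bar>" using width_h_ge width_v_ge by (auto simp: P_def Q_def)
    have "Q powr (- \<gamma>) \<le> (P / 28) powr (- \<gamma>)"
      using PQ ag by (intro powr_mono2') auto
    also have "\<dots> = 28 powr \<gamma> * P powr (- \<gamma>)"
      using PQ by (simp add: powr_divide powr_minus field_simps)
    finally have Qg: "Q powr (- \<gamma>) \<le> 28 powr \<gamma> * P powr (- \<gamma>)" .
    have "- 1/8 - \<gamma> = - \<gamma> + - 1/8" by simp
    hence "P powr (- 1/4 - \<alpha>) * Q powr (- 1/8 - \<gamma>) = P powr (- 1/4 - \<alpha>) * (Q powr (- \<gamma>) * Q powr (- 1/8))"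
      by (simp only: powr_add[symmetric])
    also have "\<dots> \<le> P powr (- 1/4 - \<alpha>) * ((28 powr \<gamma> * P powr (- \<gamma>)) * (4 * (1 + \<bar>fst y\<bar>) powr (- 2)))"
      using Qg width_v_powr_le[of y] by (intro mult_left_mono mult_mono) (auto simp: Q_def)
    also have "\<dots> = (28 powr \<gamma> * 4) * (P powr (- 1/4 - \<alpha>) * P powr (- \<gamma>)) * (1 + \<bar>fst y\<bar>) powr (- 2)"
      by (simp only: mult_ac)
    also have "P powr (- 1/4 - \<alpha>) * P powr (- \<gamma>) = P powr (- 1/4 - (\<alpha> + \<gamma>))"
    proof -
      have "- 1/4 - \<alpha> + - \<gamma> = - 1/4 - (\<alpha> + \<gamma>)" by simp
      thus ?thesis by (simp only: powr_add[symmetric])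
    qed
    also have "(28 powr \<gamma> * 4) * P powr (- 1/4 - (\<alpha> + \<gamma>)) * (1 + \<bar>fst y\<bar>) powr (- 2)
        \<le> (28 powr \<gamma> * 4) * (1 + \<bar>snd y\<bar>) powr (- 5/4) * (1 + \<bar>fst y\<bar>) powr (- 2)"
    proof -
      have "P powr (- 1/4 - (\<alpha> + \<gamma>)) \<le> P powr (- 5/4)" using PQ ag by (intro powr_mono) auto
      also have "\<dots> \<le> (1 + \<bar>snd y\<bar>) powr (- 5/4)" using PQ by (intro powr_mono2') auto
      finally show ?thesis by (intro mult_left_mono mult_right_mono) auto
    qed
    also have "\<dots> = (28 powr \<gamma> * 4) * weight y" by (simp only: weight_def mult_ac)
    finally have *: "P powr (- 1/4 - \<alpha>) * Q powr (- 1/8 - \<gamma>) \<le> (28 powr \<gamma> * 4) * weight y" .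
    have "width_h y ^ i * width_v y ^ j * \<bar>mode a b c y x\<bar>
        \<le> C * (P powr (- 1/4 - \<alpha>) * Q powr (- 1/8 - \<gamma>)) * envelope x"
      using C(2)[of y x] by (simp only: P_def Q_def \<alpha>_def \<gamma>_def mult_ac)
    also have "\<dots> \<le> C * ((28 powr \<gamma> * 4) * weight y) * envelope x"
      using C(1) * envelope_nonneg[of x] by (intro mult_right_mono mult_left_mono) auto
    finally show "width_h y ^ i * width_v y ^ j * \<bar>mode a b c y x\<bar> \<le> C * (28 powr \<gamma> * 4) * weight y * envelope x"
      by (simp only: mult_ac)
  qed (simp add: C(1))
qed

lemma continuous_on_gauss3 [continuous_intros]:
  fixes f g :: "'a::topological_space \<Rightarrow> real"
  assumes "continuous_on S f" "continuous_on S g" "continuous_on S h" "\<And>y. y \<in> S \<Longrightarrow> f y > 0" "\<And>y. y \<in> S \<Longrightarrow> g y > 0"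
  shows "continuous_on S (\<lambda>y. gauss3 a b c (f y) (g y) (h y))"
  unfolding gauss3_def by (intro continuous_intros assms) auto

lemma continuous_on_mode:
  "continuous_on UNIV (\<lambda>z. mode a b c (fst z) (snd z))"
proof -
  have "continuous_on UNIV (\<lambda>z::(real\<times>real)\<times>(real^3). width_h (fst z))"
    "continuous_on UNIV (\<lambda>z::(real\<times>real)\<times>(real^3). width_v (fst z))"
    unfolding width_h_def width_v_def by (intro continuous_intros)+
  thus ?thesis unfolding mode_def
    by (intro continuous_intros) (simp_all add: width_h_ge width_v_ge)
qed

lemma superposable_weighted_mode:
  assumes "continuous_on UNIV \<kappa>" "\<And>y. \<bar>\<kappa> y\<bar> \<le> width_h y ^ i * width_v y ^ j"
    and "2 * i \<le> a + b" "2 * j \<le> c" "2 + 2 * i + 2 * j \<le> a + b + c"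
  shows "superposable (\<lambda>y x. \<kappa> y * mode a b c y x)"
proof -
  obtain C where "C \<ge> 0 \<and> (\<forall>y x. width_h y ^ i * width_v y ^ j * \<bar>mode a b c y x\<bar> \<le> C * weight y * envelope x)"
    using mode_superposable_bound[OF assms(3-5)] by (rule exE)
  note C = conjunct1[OF this] conjunct2[OF this, rule_format]
  have "\<bar>\<kappa> y * mode a b c y x\<bar> \<le> C * weight y * envelope x" for y x
    using order_trans[OF mult_right_mono[OF assms(2) abs_ge_zero] C(2)] by (simp add: abs_mult)
  moreover have "continuous_on UNIV (\<lambda>z::(real\<times>real)\<times>(real^3). \<kappa> (fst z))"
    using continuous_on_compose2[OF assms(1), of UNIV fst] by (simp add: continuous_on_fst continuous_on_id)
  ultimately show ?thesis using C(1) unfolding superposable_def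
    by (auto intro!: continuous_intros continuous_on_mode)
qed

lemma superposable_mode:
  assumes "2 \<le> a + b + c"
  shows "superposable (mode a b c)"
  using superposable_weighted_mode[of "\<lambda>_. 1" 0 0 a b c] assms by simp

lemma superposable_time_mode:
  assumes "2 \<le> a + b" "4 \<le> a + b + c"
  shows "superposable (\<lambda>y x. \<bar>snd y\<bar> * mode a b c y x)"
  by (rule superposable_weighted_mode[of _ 1 0])
     (use assms in \<open>auto intro!: continuous_intros simp: width_h_def\<close>)

lemma superposable_height_mode:
  assumes "2 \<le> c" "4 \<le> a + b + c"
  shows "superposable (\<lambda>y x. (fst y ^ 16 + \<bar>snd y\<bar>) * mode a b c y x)"
  by (rule superposable_weighted_mode[of _ 0 1])
     (use assms even_power_16_nonneg in \<open>auto intro!: continuous_intros simp: width_v_def\<close>)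

definition has_gradient :: "(real^'n \<Rightarrow> real) \<Rightarrow> (real^'n \<Rightarrow> real^'n) \<Rightarrow> bool" where
  "has_gradient f g \<longleftrightarrow>
     (\<forall>x. (f has_derivative (\<lambda>h. g x \<bullet> h)) (at x)) \<and> continuous_on UNIV g"

lemma has_gradient_continuous: "has_gradient f g \<Longrightarrow> continuous_on UNIV f"
  unfolding has_gradient_def
  by (meson continuous_at_imp_continuous_on has_derivative_continuous)

lemma has_gradient_add:
  "has_gradient f g \<Longrightarrow> has_gradient f' g' \<Longrightarrow> has_gradient (\<lambda>x. f x + f' x) (\<lambda>x. g x + g' x)"
  unfolding has_gradient_def by (auto intro!: derivative_eq_intros continuous_intros simp: inner_add_left)

lemma has_gradient_cmult:
  "has_gradient f g \<Longrightarrow> has_gradient (\<lambda>x. c * f x) (\<lambda>x. c *\<^sub>R g x)"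
  unfolding has_gradient_def by (auto intro!: derivative_eq_intros continuous_intros)

lemma has_gradient_uminus:
  "has_gradient f g \<Longrightarrow> has_gradient (\<lambda>x. - f x) (\<lambda>x. - g x)"
  using has_gradient_cmult[of f g "-1"] by simp

lemma has_gradient_mode:
  "has_gradient (mode a b c y)
     (\<lambda>x. vector [mode (a + 1) b c y x, mode a (b + 1) c y x, mode a b (c + 1) y x])"
  unfolding has_gradient_def
proof (intro conjI allI)
  fix x :: "real^3"
  define P Q where "P = width_h y" and "Q = width_v y"
  have PQ: "P > 0" "Q > 0" using width_h_ge width_v_ge by (auto simp: P_def Q_def)
  have g: "((\<lambda>x. gauss_deriv m R (x $ k)) has_derivative (\<lambda>h. h $ k * gauss_deriv (Suc m) R (x $ k))) (at x)"
    if "R > 0" for m R and k :: 3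
    by (rule DERIV_compose_FDERIV[OF DERIV_gauss_deriv[OF that]])
       (rule bounded_linear.has_derivative[OF bounded_linear_vec_nth has_derivative_ident])
  have "((\<lambda>x. gauss_deriv a P (x $ 1) * gauss_deriv b P (x $ 2) * gauss_deriv c Q (x $ 3)) has_derivative
     (\<lambda>h. gauss_deriv a P (x $ 1) * gauss_deriv b P (x $ 2) * (h $ 3 * gauss_deriv (Suc c) Q (x $ 3))
        + (gauss_deriv a P (x $ 1) * (h $ 2 * gauss_deriv (Suc b) P (x $ 2))
           + h $ 1 * gauss_deriv (Suc a) P (x $ 1) * gauss_deriv b P (x $ 2)) * gauss_deriv c Q (x $ 3))) (at x)"
    by (intro has_derivative_mult g PQ)
  moreover have "mode a b c y = (\<lambda>x. gauss_deriv a P (x $ 1) * gauss_deriv b P (x $ 2) * gauss_deriv c Q (x $ 3))"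
    by (simp add: mode_def gauss3_def P_def Q_def fun_eq_iff)
  ultimately show "(mode a b c y has_derivative (\<bullet>)
      (vector [mode (a + 1) b c y x, mode a (b + 1) c y x, mode a b (c + 1) y x])) (at x)"
    by (elim has_derivative_eq_rhs ssubst)
       (simp add: fun_eq_iff inner_vec_def sum_3 mode_def gauss3_def P_def Q_def algebra_simps del: gauss_deriv.simps)
next
  have c: "continuous_on UNIV (mode a b c y)" for a b c
    unfolding mode_def using width_h_ge(3)[of y] width_v_ge(2)[of y] by (intro continuous_intros) auto
  have e: "vector [p, q, r] = (\<chi> i::3. if i = 1 then p else if i = 2 then q else r)" for p q r :: real
    by (simp add: vec_eq_iff forall_3)
  show "continuous_on UNIV (\<lambda>x. vector [mode (a + 1) b c y x, mode a (b + 1) c y x, mode a b (c + 1) y x] :: real^3)"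
    unfolding e
  proof (rule continuous_on_vec_lambda)
    fix i :: 3
    show "continuous_on UNIV (\<lambda>x. if i = 1 then mode (a + 1) b c y x else if i = 2 then mode a (b + 1) c y x else mode a b (c + 1) y x)"
      using c by (cases "i = 1"; cases "i = 2") auto
  qed
qed

lemma mode_recursion:
  "a > 0 \<Longrightarrow> x $ 1 * mode a b c y x = - (width_h y / 2) * mode (a + 1) b c y x - real a * mode (a - 1) b c y x"
  "b > 0 \<Longrightarrow> x $ 2 * mode a b c y x = - (width_h y / 2) * mode a (b + 1) c y x - real b * mode a (b - 1) c y x"
  "c > 0 \<Longrightarrow> x $ 3 * mode a b c y x = - (width_v y / 2) * mode a b (c + 1) y x - real c * mode a b (c - 1) y x"
proof -
  have r: "s * gauss_deriv m P s = - (P / 2) * gauss_deriv (m + 1) P s - real m * gauss_deriv (m - 1) P s"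
    if "m > 0" "P > 0" for m P s
    using gauss_deriv_recursion[OF that(2), of s "m - 1"] that(1) by (simp del: gauss_deriv.simps)
  show "x $ 1 * mode a b c y x = - (width_h y / 2) * mode (a + 1) b c y x - real a * mode (a - 1) b c y x" if "a > 0"
  proof -
    have "x $ 1 * mode a b c y x = (x $ 1 * gauss_deriv a (width_h y) (x $ 1))
        * (gauss_deriv b (width_h y) (x $ 2) * gauss_deriv c (width_v y) (x $ 3))"
      by (simp add: mode_def gauss3_def)
    also note r[OF that width_h_ge(3)]
    finally show ?thesis by (simp add: mode_def gauss3_def algebra_simps del: gauss_deriv.simps)
  qed
  show "x $ 2 * mode a b c y x = - (width_h y / 2) * mode a (b + 1) c y x - real b * mode a (b - 1) c y x" if "b > 0"
  proof -
    have "x $ 2 * mode a b c y x = (x $ 2 * gauss_deriv b (width_h y) (x $ 2))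
        * (gauss_deriv a (width_h y) (x $ 1) * gauss_deriv c (width_v y) (x $ 3))"
      by (simp add: mode_def gauss3_def)
    also note r[OF that width_h_ge(3)]
    finally show ?thesis by (simp add: mode_def gauss3_def algebra_simps del: gauss_deriv.simps)
  qed
  show "x $ 3 * mode a b c y x = - (width_v y / 2) * mode a b (c + 1) y x - real c * mode a b (c - 1) y x" if "c > 0"
  proof -
    have "x $ 3 * mode a b c y x = (x $ 3 * gauss_deriv c (width_v y) (x $ 3))
        * (gauss_deriv a (width_h y) (x $ 1) * gauss_deriv b (width_h y) (x $ 2))"
      by (simp add: mode_def gauss3_def)
    also note r[OF that width_v_ge(2)]
    finally show ?thesis by (simp add: mode_def gauss3_def algebra_simps del: gauss_deriv.simps)
  qed
qed

section \<open>Cancellation of the residual\<close>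

lemma integral_even_FTC:
  fixes g m :: "real \<Rightarrow> real"
  assumes int: "integrable lborel (\<lambda>t. g \<bar>t\<bar>)"
    and der: "\<And>t. t \<ge> 0 \<Longrightarrow> (m has_real_derivative g t) (at t)"
    and cont: "continuous_on UNIV (\<lambda>t. g \<bar>t\<bar>)"
    and lim: "(m \<longlongrightarrow> L) at_top"
  shows "(\<integral>t. g \<bar>t\<bar> \<partial>lborel) = 2 * (L - m 0)"
proof -
  let ?f = "\<lambda>t. g \<bar>t\<bar>"
  define s where "s = (\<lambda>n t. indicator {- real n..0} t *\<^sub>R ?f t + indicator {0..real n} t *\<^sub>R ?f t)"
  have i: "integrable lborel (\<lambda>t. indicator {- real n..0} t *\<^sub>R ?f t)"
    "integrable lborel (\<lambda>t. indicator {0..real n} t *\<^sub>R ?f t)" for n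
    using integrable_mult_indicator[OF _ int] by simp_all
  have "(\<integral>t. indicator {0..real n} t *\<^sub>R ?f t \<partial>lborel) = m (real n) - m 0" for n
  proof (rule integral_FTC_atLeastAtMost)
    show "(m has_vector_derivative ?f t) (at t within {0..real n})" if "0 \<le> t" "t \<le> real n" for t
      using der[of t] that by (simp add: has_real_derivative_iff_has_vector_derivative has_vector_derivative_at_within)
  qed (auto intro: continuous_on_subset[OF cont])
  moreover have "(\<integral>t. indicator {- real n..0} t *\<^sub>R ?f t \<partial>lborel) = (- m (- 0)) - (- m (- (- real n)))" for n
  proof (rule integral_FTC_atLeastAtMost)
    show "((\<lambda>t. - m (- t)) has_vector_derivative ?f t) (at t within {- real n..0})" if "- real n \<le> t" "t \<le> 0" for t
    proof -
      have "((\<lambda>t. m (- t)) has_real_derivative g (- t) * (- 1)) (at t)"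
        by (rule DERIV_chain2[OF der]) (use that in \<open>auto intro!: derivative_eq_intros\<close>)
      from DERIV_minus[OF this] show ?thesis
        using that by (simp add: has_real_derivative_iff_has_vector_derivative has_vector_derivative_at_within)
    qed
  qed (auto intro: continuous_on_subset[OF cont])
  ultimately have val: "(\<integral>t. s n t \<partial>lborel) = 2 * (m (real n) - m 0)" for n
    unfolding s_def using i[of n] by simp
  have "(\<lambda>n. \<integral>t. s n t \<partial>lborel) \<longlonglongrightarrow> (\<integral>t. ?f t \<partial>lborel)"
  proof (rule integral_dominated_convergence)
    show "?f \<in> borel_measurable lborel" using int by simp
    show "s n \<in> borel_measurable lborel" for n
      unfolding s_def by (rule borel_measurable_integrable) (intro Bochner_Integration.integrable_add i)
    show "integrable lborel (\<lambda>t. 2 * norm (?f t))" using int by simp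
    show "AE t in lborel. norm (s n t) \<le> 2 * norm (?f t)" for n
      by (intro AE_I2) (auto simp: s_def indicator_def)
    have "(\<lambda>n. s n t) \<longlonglongrightarrow> ?f t" if "t \<noteq> 0" for t
    proof (rule tendsto_eventually)
      have "eventually (\<lambda>n. \<bar>t\<bar> \<le> real n) sequentially"
        using eventually_ge_at_top[of "nat \<lceil>\<bar>t\<bar>\<rceil>"] by eventually_elim linarith
      thus "eventually (\<lambda>n. s n t = ?f t) sequentially"
        by eventually_elim (use that in \<open>auto simp: s_def indicator_def\<close>)
    qed
    thus "AE t in lborel. (\<lambda>n. s n t) \<longlonglongrightarrow> ?f t"
      using AE_lborel_singleton[of 0] by auto
  qed
  moreover have "(\<lambda>n. \<integral>t. s n t \<partial>lborel) \<longlonglongrightarrow> 2 * (L - m 0)"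
    unfolding val by (intro tendsto_intros filterlim_compose[OF lim filterlim_real_sequentially])
  ultimately show ?thesis by (rule LIMSEQ_unique)
qed

text \<open>With \<open>X\<close> and \<open>Z\<close> for the horizontal and vertical Laplacian and \<open>G\<close> for the mode without
  derivatives, this is \<open>((\<bar>t\<bar>/40) X + (7/10) (r ^ 16 + \<bar>t\<bar>) Z) (X + Z) G + (11/40) X G + (119/40) Z G\<close>,
  which is, up to its sign, the part of the linearised equation for one mode that is not a gradient.\<close>

definition residual :: "real \<times> real \<Rightarrow> real^3 \<Rightarrow> real" where
  "residual y x = \<bar>snd y\<bar> / 40 * (mode 4 0 0 y x + 2 * mode 2 2 0 y x + mode 0 4 0 y x + mode 2 0 2 y x + mode 0 2 2 y x)
     + 7/10 * (fst y ^ 16 + \<bar>snd y\<bar>) * (mode 2 0 2 y x + mode 0 2 2 y x + mode 0 0 4 y x)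
     + 11/40 * (mode 2 0 0 y x + mode 0 2 0 y x) + 119/40 * mode 0 0 2 y x"

lemma superposable_residual: "superposable residual"
proof -
  have "superposable (\<lambda>y x. 
      1/40 * (\<bar>snd y\<bar> * mode 4 0 0 y x) + 2/40 * (\<bar>snd y\<bar> * mode 2 2 0 y x) + 1/40 * (\<bar>snd y\<bar> * mode 0 4 0 y x)
    + 1/40 * (\<bar>snd y\<bar> * mode 2 0 2 y x) + 1/40 * (\<bar>snd y\<bar> * mode 0 2 2 y x)
    + 7/10 * ((fst y ^ 16 + \<bar>snd y\<bar>) * mode 2 0 2 y x) + 7/10 * ((fst y ^ 16 + \<bar>snd y\<bar>) * mode 0 2 2 y x)
    + 7/10 * ((fst y ^ 16 + \<bar>snd y\<bar>) * mode 0 0 4 y x)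
    + 11/40 * mode 2 0 0 y x + 11/40 * mode 0 2 0 y x + 119/40 * mode 0 0 2 y x)"
    by (intro superposable_add superposable_cmult superposable_time_mode superposable_height_mode superposable_mode) simp_all
  also have "(\<lambda>y x. 
      1/40 * (\<bar>snd y\<bar> * mode 4 0 0 y x) + 2/40 * (\<bar>snd y\<bar> * mode 2 2 0 y x) + 1/40 * (\<bar>snd y\<bar> * mode 0 4 0 y x)
    + 1/40 * (\<bar>snd y\<bar> * mode 2 0 2 y x) + 1/40 * (\<bar>snd y\<bar> * mode 0 2 2 y x)
    + 7/10 * ((fst y ^ 16 + \<bar>snd y\<bar>) * mode 2 0 2 y x) + 7/10 * ((fst y ^ 16 + \<bar>snd y\<bar>) * mode 0 2 2 y x)
    + 7/10 * ((fst y ^ 16 + \<bar>snd y\<bar>) * mode 0 0 4 y x)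
    + 11/40 * mode 2 0 0 y x + 11/40 * mode 0 2 0 y x + 119/40 * mode 0 0 2 y x) = residual"
    unfolding residual_def by (intro ext) argo
  finally show ?thesis .
qed

lemma DERIV_gauss3_widths:
  assumes p: "(p has_real_derivative p') (at t)" "p t > 0" and q: "(q has_real_derivative q') (at t)" "q t > 0"
  shows "((\<lambda>t. gauss3 a b c (p t) (q t) x) has_real_derivative
     (p' * (gauss3 (a + 2) b c (p t) (q t) x + gauss3 a (b + 2) c (p t) (q t) x)
      + q' * gauss3 a b (c + 2) (p t) (q t) x) / 4) (at t)"
proof -
  have P: "((\<lambda>t. gauss_deriv m (p t) s) has_real_derivative gauss_deriv (Suc (Suc m)) (p t) s / 4 * p') (at t)" for m s
    by (rule DERIV_chain2[OF DERIV_gauss_deriv_width[OF p(2)] p(1)])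
  have Q: "((\<lambda>t. gauss_deriv m (q t) s) has_real_derivative gauss_deriv (Suc (Suc m)) (q t) s / 4 * q') (at t)" for m s
    by (rule DERIV_chain2[OF DERIV_gauss_deriv_width[OF q(2)] q(1)])
  show ?thesis unfolding gauss3_def
    by (rule DERIV_cong[OF DERIV_mult[OF DERIV_mult[OF P P] Q]])
       (simp add: algebra_simps add_divide_distrib del: gauss_deriv.simps)
qed

text \<open>This and the next lemma dispose of the boundary terms at infinity in the two parameters.\<close>

lemma weighted_mode_tendsto_0:
  assumes "\<And>t. \<bar>\<kappa> t\<bar> \<le> width_h (r, t) ^ i * width_v (r, t) ^ j" "2 * i \<le> a + b" "2 * j \<le> c"
  shows "((\<lambda>t. \<kappa> t * mode a b c (r, t) x) \<longlongrightarrow> 0) at_top"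
proof -
  obtain C where "C \<ge> 0 \<and> (\<forall>y x. width_h y ^ i * width_v y ^ j * \<bar>mode a b c y x\<bar>
     \<le> C * width_h y powr (- 1/4) * width_v y powr (- 1/8) * envelope x)"
    using mode_decay_coarse[OF assms(2,3)] by (rule exE)
  note C = conjunct1[OF this] conjunct2[OF this, rule_format]
  have bound: "\<bar>\<kappa> t * mode a b c (r, t) x\<bar> \<le> C * envelope x * (1 + \<bar>t\<bar>) powr (- 1/4)" for t
  proof -
    have "\<bar>\<kappa> t * mode a b c (r, t) x\<bar> \<le> C * width_h (r, t) powr (- 1/4) * width_v (r, t) powr (- 1/8) * envelope x"
      using order_trans[OF mult_right_mono[OF assms(1) abs_ge_zero] C(2)] by (simp only: abs_mult)
    also have "\<dots> \<le> C * (1 + \<bar>t\<bar>) powr (- 1/4) * 1 * envelope x"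
    proof (intro mult_right_mono mult_mono mult_left_mono)
      show "width_h (r, t) powr (- 1/4) \<le> (1 + \<bar>t\<bar>) powr (- 1/4)"
        using width_h_ge(1)[of "(r, t)"] by (intro powr_mono2') auto
      show "width_v (r, t) powr (- 1/8) \<le> 1"
        using powr_mono2'[of "- 1/8" 1 "width_v (r, t)"] width_v_ge(1)[of "(r, t)"] by simp
    qed (use C(1) envelope_nonneg in simp_all)
    finally show ?thesis by (simp only: mult_ac mult_1)
  qed
  have "((\<lambda>t::real. C * envelope x * (1 + \<bar>t\<bar>) powr (- 1/4)) \<longlongrightarrow> 0) at_top"
  proof -
    have "((\<lambda>t::real. (1 + \<bar>t\<bar>) powr (- 1/4)) \<longlongrightarrow> 0) at_top" by real_asymp
    from tendsto_mult_left[OF this, of "C * envelope x"] show ?thesis by simp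
  qed
  thus ?thesis
    by (rule Lim_null_comparison[rotated]) (intro always_eventually allI, simp only: real_norm_def bound)
qed

lemma radial_mode_tendsto_0:
  "((\<lambda>r. r * mode 0 0 0 (r, 0) x) \<longlongrightarrow> 0) at_top"
proof -
  have "\<exists>C\<ge>0. \<forall>y x. width_h y ^ 0 * width_v y ^ 0 * \<bar>mode 0 0 0 y x\<bar>
     \<le> C * width_h y powr (- 1/4) * width_v y powr (- 1/8) * envelope x"
    by (rule mode_decay_coarse) simp_all
  then obtain C where "C \<ge> 0 \<and> (\<forall>y x. width_h y ^ 0 * width_v y ^ 0 * \<bar>mode 0 0 0 y x\<bar>
     \<le> C * width_h y powr (- 1/4) * width_v y powr (- 1/8) * envelope x)"
    by (rule exE)
  note C = conjunct1[OF this] conjunct2[OF this, rule_format]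
  have bound: "\<bar>r * mode 0 0 0 (r, 0) x\<bar> \<le> (4 * C * envelope x) * (\<bar>r\<bar> * (1 + \<bar>r\<bar>) powr (- 2))" for r
  proof -
    have "\<bar>mode 0 0 0 (r, 0) x\<bar> \<le> C * width_h (r, 0) powr (- 1/4) * width_v (r, 0) powr (- 1/8) * envelope x"
      using C(2)[of "(r, 0)" x] by simp
    also have "\<dots> \<le> C * 1 * (4 * (1 + \<bar>r\<bar>) powr (- 2)) * envelope x"
    proof (intro mult_right_mono mult_mono mult_left_mono)
      show "width_h (r, 0) powr (- 1/4) \<le> 1"
        using powr_mono2'[of "- 1/4" 1 "width_h (r, 0)"] width_h_ge(2)[of "(r, 0)"] by simp
      show "width_v (r, 0) powr (- 1/8) \<le> 4 * (1 + \<bar>r\<bar>) powr (- 2)"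
        using width_v_powr_le[of "(r, 0)"] by simp
    qed (use C(1) envelope_nonneg in simp_all)
    finally have "\<bar>mode 0 0 0 (r, 0) x\<bar> \<le> C * 1 * (4 * (1 + \<bar>r\<bar>) powr (- 2)) * envelope x" .
    from mult_left_mono[OF this abs_ge_zero[of r]] show ?thesis
      by (simp only: abs_mult mult_ac mult_1)
  qed
  have "((\<lambda>r::real. (4 * C * envelope x) * (\<bar>r\<bar> * (1 + \<bar>r\<bar>) powr (- 2))) \<longlongrightarrow> 0) at_top"
  proof -
    have "((\<lambda>r::real. \<bar>r\<bar> * (1 + \<bar>r\<bar>) powr (- 2)) \<longlongrightarrow> 0) at_top" by real_asymp
    from tendsto_mult_left[OF this, of "4 * C * envelope x"] show ?thesis by simp
  qed
  thus ?thesis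
    by (rule Lim_null_comparison[rotated]) (intro always_eventually allI, simp only: real_norm_def bound)
qed

text \<open>For \<open>t > 0\<close> the heat equation gives \<open>\<partial>\<^sub>t G = (X + Z) G / 4\<close>, and the residual is \<open>4 \<partial>\<^sub>t\<close> of
  \<open>(7/40) G + (t/40) X G + (7/10) (r ^ 16 + t) Z G\<close>. Only the value at \<open>t = 0\<close> survives; the two
  half-lines contribute equally.\<close>

lemma time_integral_residual:
  assumes "integrable lborel (\<lambda>t. residual (r, t) x)"
  shows "(\<integral>t. residual (r, t) x \<partial>lborel) = - 7/5 * (mode 0 0 0 (r, 0) x + 4 * r ^ 16 * mode 0 0 2 (r, 0) x)"
proof -
  define G where "G = (\<lambda>a b c t. gauss3 a b c (40 + t) (10/7 + r ^ 16 + t) x)"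
  have mode: "mode a b c (r, t) x = G a b c \<bar>t\<bar>" for a b c t
    by (simp add: mode_def G_def width_h_def width_v_def)
  define m where "m = (\<lambda>t. 4 * (7/40 * G 0 0 0 t + t / 40 * (G 2 0 0 t + G 0 2 0 t) + 7/10 * (r ^ 16 + t) * G 0 0 2 t))"
  define g where "g = (\<lambda>t. t / 40 * (G 4 0 0 t + 2 * G 2 2 0 t + G 0 4 0 t + G 2 0 2 t + G 0 2 2 t)
     + 7/10 * (r ^ 16 + t) * (G 2 0 2 t + G 0 2 2 t + G 0 0 4 t)
     + 11/40 * (G 2 0 0 t + G 0 2 0 t) + 119/40 * G 0 0 2 t)"
  have gr: "g \<bar>t\<bar> = residual (r, t) x" for t
    by (simp add: g_def residual_def mode)
  have "(\<integral>t. g \<bar>t\<bar> \<partial>lborel) = 2 * (0 - m 0)"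
  proof (rule integral_even_FTC)
    show "integrable lborel (\<lambda>t. g \<bar>t\<bar>)" using assms by (simp add: gr)
    have "continuous_on UNIV (\<lambda>t. residual (r, t) x)"
      using continuous_on_compose2[OF superposable_continuous_slices(2)[OF superposable_residual, of x], of UNIV "\<lambda>t. (r, t)"]
      by (simp add: continuous_on_Pair continuous_on_const continuous_on_id)
    thus "continuous_on UNIV (\<lambda>t. g \<bar>t\<bar>)" by (simp add: gr)
    fix t :: real assume t: "t \<ge> 0"
    have dG: "(G a b c has_real_derivative (G (a + 2) b c t + G a (b + 2) c t + G a b (c + 2) t) / 4) (at t)" for a b c
    proof -
      have "((\<lambda>t. gauss3 a b c (40 + t) (10/7 + r ^ 16 + t) x) has_real_derivative
         (1 * (gauss3 (a + 2) b c (40 + t) (10/7 + r ^ 16 + t) x + gauss3 a (b + 2) c (40 + t) (10/7 + r ^ 16 + t) x)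
          + 1 * gauss3 a b (c + 2) (40 + t) (10/7 + r ^ 16 + t) x) / 4) (at t)"
        by (rule DERIV_gauss3_widths)
           (use t even_power_16_nonneg[of r] in \<open>auto intro!: derivative_eq_intros add_pos_nonneg\<close>)
      thus ?thesis by (simp add: G_def)
    qed
    have n: "0 + 2 = (2::nat)" "2 + 2 = (4::nat)" by simp_all
    have "(m has_real_derivative 4 * (7/40 * ((G (0+2) 0 0 t + G 0 (0+2) 0 t + G 0 0 (0+2) t) / 4)
       + (1 / 40 * (G 2 0 0 t + G 0 2 0 t)
          + ((G (2+2) 0 0 t + G 2 (0+2) 0 t + G 2 0 (0+2) t) / 4 + (G (0+2) 2 0 t + G 0 (2+2) 0 t + G 0 2 (0+2) t) / 4) * (t / 40))
       + (7/10 * G 0 0 2 t + (G (0+2) 0 2 t + G 0 (0+2) 2 t + G 0 0 (2+2) t) / 4 * (7/10 * (r ^ 16 + t))))) (at t)"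
      unfolding m_def
      by (intro DERIV_cmult DERIV_add DERIV_mult dG) (auto intro!: derivative_eq_intros)
    thus "(m has_real_derivative g t) (at t)"
      by (rule DERIV_cong) (simp only: n g_def, simp add: algebra_simps add_divide_distrib)
  next
    have "((\<lambda>t. 4 * (7/40 * (1 * mode 0 0 0 (r, t) x) + (1/40 * (t * mode 2 0 0 (r, t) x) + 1/40 * (t * mode 0 2 0 (r, t) x))
       + 7/10 * ((r ^ 16 + \<bar>t\<bar>) * mode 0 0 2 (r, t) x))) \<longlongrightarrow> 4 * (7/40 * 0 + (1/40 * 0 + 1/40 * 0) + 7/10 * 0)) at_top"
    proof (intro tendsto_intros)
      show "((\<lambda>t. 1 * mode 0 0 0 (r, t) x) \<longlongrightarrow> 0) at_top"
        by (rule weighted_mode_tendsto_0[of _ _ 0 0]) auto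
      show "((\<lambda>t. t * mode 2 0 0 (r, t) x) \<longlongrightarrow> 0) at_top" "((\<lambda>t. t * mode 0 2 0 (r, t) x) \<longlongrightarrow> 0) at_top"
        by (rule weighted_mode_tendsto_0[of _ _ 1 0]; simp add: width_h_def)+
      show "((\<lambda>t. (r ^ 16 + \<bar>t\<bar>) * mode 0 0 2 (r, t) x) \<longlongrightarrow> 0) at_top"
        by (rule weighted_mode_tendsto_0[of _ _ 0 1]) (use even_power_16_nonneg[of r] in \<open>auto simp: width_v_def\<close>)
    qed
    moreover have "eventually (\<lambda>t. 4 * (7/40 * (1 * mode 0 0 0 (r, t) x) + (1/40 * (t * mode 2 0 0 (r, t) x) + 1/40 * (t * mode 0 2 0 (r, t) x))
       + 7/10 * ((r ^ 16 + \<bar>t\<bar>) * mode 0 0 2 (r, t) x)) = m t) at_top"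
      using eventually_ge_at_top[of 0]
      by eventually_elim (simp add: mode m_def algebra_simps)
    ultimately show "(m \<longlongrightarrow> 0) at_top"
      by (simp add: tendsto_cong)
  qed
  moreover have "m 0 = 7/10 * (mode 0 0 0 (r, 0) x + 4 * r ^ 16 * mode 0 0 2 (r, 0) x)"
    by (simp add: m_def mode algebra_simps)
  ultimately show ?thesis by (simp add: gr)
qed

text \<open>What the integration over \<open>t\<close> leaves is \<open>G + 4 r ^ 16 Z G\<close> at \<open>t = 0\<close>, up to a constant. This is
  \<open>\<partial>\<^sub>r (r G)\<close>, because \<open>\<partial>\<^sub>r G = 4 r ^ 15 Z G\<close>. The ratio of the two coefficients is what ties the exponent 16 to
  the eigenvalue.\<close>

lemma superposition_residual_eq_0: "superposition residual x = 0"
proof -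
  have int: "integrable (lborel \<Otimes>\<^sub>M lborel) (\<lambda>y. residual y x)"
    using superposable_integrable[OF superposable_residual] by (simp add: lborel_prod)
  have val: "superposition residual x = (\<integral>r. (\<integral>t. residual (r, t) x \<partial>lborel) \<partial>lborel)"
    using lborel_pair.integral_fst'[OF int] by (simp add: superposition_def lborel_prod)
  define g where "g = (\<lambda>r. mode 0 0 0 (r, 0) x + 4 * r ^ 16 * mode 0 0 2 (r, 0) x)"
  have even: "g \<bar>r\<bar> = g r" for r
    by (simp add: g_def mode_def width_h_def width_v_def power_even_abs)
  have cm: "continuous_on UNIV (\<lambda>r. mode a b c (r, 0) x)" for a b c
    unfolding mode_def width_h_def width_v_def
    by (intro continuous_intros) (simp_all add: even_power_16_nonneg add_pos_nonneg)
  have cont: "continuous_on UNIV g" unfolding g_def by (intro continuous_intros cm)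
  have ae: "AE r in lborel. (\<integral>t. residual (r, t) x \<partial>lborel) = - 7/5 * g r"
    using lborel_pair.AE_integrable_fst'[OF int]
    by eventually_elim (simp only: time_integral_residual g_def)
  have "integrable lborel (\<lambda>r. \<integral>t. residual (r, t) x \<partial>lborel)"
    using lborel_pair.integrable_fst'[OF int] .
  moreover have gm [measurable]: "g \<in> borel_measurable borel"
    using cont by (rule borel_measurable_continuous_onI)
  ultimately have "integrable lborel (\<lambda>r. - 7/5 * g r)"
    using ae by (intro integrable_cong_AE_imp[where f="\<lambda>r. - 7/5 * g r"]) simp_all
  hence "integrable lborel (\<lambda>r. (- 5/7) * (- 7/5 * g r))" by (rule integrable_mult_right)
  hence "integrable lborel g" by simp
  moreover have "(\<integral>r. g \<bar>r\<bar> \<partial>lborel) = 2 * (0 - 0 * mode 0 0 0 (0, 0) x)"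
  proof (rule integral_even_FTC[where g=g and m="\<lambda>r. r * mode 0 0 0 (r, 0) x"])
    show "integrable lborel (\<lambda>r. g \<bar>r\<bar>)" using \<open>integrable lborel g\<close> by (simp add: even)
    show "continuous_on UNIV (\<lambda>r. g \<bar>r\<bar>)" using cont by (simp add: even)
    show "((\<lambda>r. r * mode 0 0 0 (r, 0) x) \<longlongrightarrow> 0) at_top" by (rule radial_mode_tendsto_0)
    fix r :: real
    have "((\<lambda>r. gauss3 0 0 0 40 (10/7 + r ^ 16) x) has_real_derivative
       (0 * (gauss3 (0 + 2) 0 0 40 (10/7 + r ^ 16) x + gauss3 0 (0 + 2) 0 40 (10/7 + r ^ 16) x)
        + 16 * r ^ 15 * gauss3 0 0 (0 + 2) 40 (10/7 + r ^ 16) x) / 4) (at r)"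
      by (rule DERIV_gauss3_widths) (auto intro!: derivative_eq_intros add_pos_nonneg simp: even_power_16_nonneg)
    moreover have "mode a b c (r, 0) x = gauss3 a b c 40 (10/7 + r ^ 16) x" for a b c r
      by (simp add: mode_def width_h_def width_v_def)
    ultimately have "((\<lambda>r. mode 0 0 0 (r, 0) x) has_real_derivative 4 * r ^ 15 * mode 0 0 2 (r, 0) x) (at r)"
      by (simp add: numeral_2_eq_2 mult.assoc)
    from DERIV_mult[OF DERIV_ident this]
    show "((\<lambda>r. r * mode 0 0 0 (r, 0) x) has_real_derivative g r) (at r)"
      by (rule DERIV_cong) (simp add: g_def power_numeral_reduce)
  qed
  ultimately have "(\<integral>r. g r \<partial>lborel) = 0" by (simp add: even)
  moreover have "(\<integral>r. (\<integral>t. residual (r, t) x \<partial>lborel) \<partial>lborel) = (\<integral>r. - 7/5 * g r \<partial>lborel)"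
    by (rule integral_cong_AE)
       (use ae lborel_pair.integrable_fst'[OF int] in \<open>simp_all add: borel_measurable_integrable\<close>)
  ultimately show ?thesis by (simp add: val)
qed

section \<open>Pairing with test fields\<close>

lemma test_field_continuous:
  fixes \<phi> :: "real^'n \<Rightarrow> real^'m"
  assumes "test_function \<phi>"
  shows "continuous_on UNIV (\<lambda>x. \<phi> x $ i)"
  using test_field_component(1)[OF assms]
  by (meson continuous_at_imp_continuous_on has_derivative_continuous)

lemma test_field_compact_support:
  fixes \<phi> :: "real^'n \<Rightarrow> real^'m"
  assumes "test_function \<phi>"
  obtains K where "compact K" "\<And>x i. x \<notin> K \<Longrightarrow> \<phi> x $ i = 0"
    "\<And>x i j. x \<notin> K \<Longrightarrow> jacobian_at \<phi> x $ i $ j = 0"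
proof -
  obtain K where K: "compact K" "\<And>x. x \<notin> K \<Longrightarrow> \<phi> x = 0"
    by (rule test_function_compact_support[OF assms]) (rule that)
  have "frechet_derivative \<phi> (at x) = (\<lambda>h. 0)" if "x \<notin> K" for x
    using derivative_eq_0_outside[OF test_function_derivative[OF assms] compact_imp_closed[OF K(1)] K(2) that] .
  hence "jacobian_at \<phi> x $ i $ j = 0" if "x \<notin> K" for x i j
    using that by (simp add: jacobian_at_def matrix_def)
  thus ?thesis using that K by simp
qed

lemma test_field_integrable:
  fixes \<phi> :: "real^'n \<Rightarrow> real^'m"
  assumes "test_function \<phi>" "continuous_on UNIV c"
  shows "integrable lborel (\<lambda>x. c x * \<phi> x $ i)" "integrable lborel (\<lambda>x. c x * jacobian_at \<phi> x $ i $ j)"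
proof -
  obtain K where K: "compact K" "\<And>x i. x \<notin> K \<Longrightarrow> \<phi> x $ i = 0"
    "\<And>x i j. x \<notin> K \<Longrightarrow> jacobian_at \<phi> x $ i $ j = 0"
    by (rule test_field_compact_support[OF assms(1)]) (rule that)
  show "integrable lborel (\<lambda>x. c x * \<phi> x $ i)"
    by (rule integrable_continuous_compact_support[OF _ K(1)])
       (auto intro!: continuous_intros assms test_field_continuous simp: K)
  show "integrable lborel (\<lambda>x. c x * jacobian_at \<phi> x $ i $ j)"
    by (rule integrable_continuous_compact_support[OF _ K(1)])
       (auto intro!: continuous_intros assms test_field_component(2) simp: K)
qed

lemma integral_gradient_test_field:
  fixes \<phi> :: "real^'n \<Rightarrow> real^'m"
  assumes \<phi>: "test_function \<phi>" and f: "has_gradient f g"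
  shows "(\<integral>x. f x * jacobian_at \<phi> x $ i $ j \<partial>lborel) = - (\<integral>x. g x $ j * \<phi> x $ i \<partial>lborel)"
proof -
  obtain K where K: "compact K" "\<And>x i. x \<notin> K \<Longrightarrow> \<phi> x $ i = 0"
    by (rule test_field_compact_support[OF \<phi>]) (rule that)
  have J: "(jacobian_at \<phi> x *v axis j 1) $ i = jacobian_at \<phi> x $ i $ j" for x
    by (simp add: matrix_vector_mult_basis column_def)
  have "(\<integral>x. f x * (jacobian_at \<phi> x *v axis j 1) $ i \<partial>lborel) = - (\<integral>x. g x \<bullet> axis j 1 * \<phi> x $ i \<partial>lborel)"
  proof (rule integral_by_parts_compact_support[where f'="\<lambda>x h. g x \<bullet> h" and g'="\<lambda>x h. (jacobian_at \<phi> x *v h) $ i"])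
    show "(f has_derivative (\<bullet>) (g x)) (at x)" for x using f by (simp add: has_gradient_def)
    show "continuous_on UNIV (\<lambda>x. g x \<bullet> axis j 1)"
      using f by (auto simp: has_gradient_def intro!: continuous_intros)
    show "continuous_on UNIV (\<lambda>x. (jacobian_at \<phi> x *v axis j 1) $ i)"
      unfolding J by (rule test_field_component(2)[OF \<phi>])
  qed (use K test_field_component(1)[OF \<phi>] in auto)
  thus ?thesis by (simp add: J inner_axis)
qed

text \<open>Gradients are invisible to solenoidal test fields: this is how the pressure disappears.\<close>

lemma integral_gradient_solenoidal:
  fixes \<phi> :: "real^'n \<Rightarrow> real^'n"
  assumes \<phi>: "solenoidal_test_field \<phi>" and f: "has_gradient f g"
  shows "(\<integral>x. (\<Sum>i\<in>UNIV. g x $ i * \<phi> x $ i) \<partial>lborel) = 0"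
proof -
  have t: "test_function \<phi>" and tr: "\<And>x. (\<Sum>i\<in>UNIV. jacobian_at \<phi> x $ i $ i) = 0"
    using \<phi> by (auto simp: solenoidal_test_field_def trace_def)
  have cg: "continuous_on UNIV (\<lambda>x. g x $ i)" for i
    using f by (auto simp: has_gradient_def intro!: continuous_intros)
  have "(\<integral>x. (\<Sum>i\<in>UNIV. g x $ i * \<phi> x $ i) \<partial>lborel) = (\<Sum>i\<in>UNIV. \<integral>x. g x $ i * \<phi> x $ i \<partial>lborel)"
    by (rule Bochner_Integration.integral_sum) (rule test_field_integrable[OF t cg])
  also have "\<dots> = (\<Sum>i\<in>UNIV. - (\<integral>x. f x * jacobian_at \<phi> x $ i $ i \<partial>lborel))"
    by (simp add: integral_gradient_test_field[OF t f])
  also have "\<dots> = - (\<integral>x. (\<Sum>i\<in>UNIV. f x * jacobian_at \<phi> x $ i $ i) \<partial>lborel)"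
    by (subst Bochner_Integration.integral_sum)
       (auto simp: sum_negf intro!: test_field_integrable[OF t has_gradient_continuous[OF f]])
  also have "\<dots> = 0" by (simp add: tr flip: sum_distrib_left)
  finally show ?thesis .
qed

lemma integral_gradient_test_function:
  fixes \<psi> :: "real^'n \<Rightarrow> real"
  assumes \<psi>: "test_function \<psi>" and f: "has_gradient f g"
  shows "(\<integral>x. f x * frechet_derivative \<psi> (at x) (axis j 1) \<partial>lborel) = - (\<integral>x. g x $ j * \<psi> x \<partial>lborel)"
proof -
  obtain K where K: "compact K" "\<And>x. x \<notin> K \<Longrightarrow> \<psi> x = 0"
    by (rule test_function_compact_support[OF \<psi>]) (rule that)
  have "(\<integral>x. f x * frechet_derivative \<psi> (at x) (axis j 1) \<partial>lborel) = - (\<integral>x. g x \<bullet> axis j 1 * \<psi> x \<partial>lborel)"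
  proof (rule integral_by_parts_compact_support[where f'="\<lambda>x h. g x \<bullet> h"])
    show "(f has_derivative (\<bullet>) (g x)) (at x)" for x using f by (simp add: has_gradient_def)
    show "continuous_on UNIV (\<lambda>x. g x \<bullet> axis j 1)"
      using f by (auto simp: has_gradient_def intro!: continuous_intros)
  qed (use K test_function_derivative[OF \<psi>] test_function_continuous_derivative[OF \<psi>] in auto)
  thus ?thesis by (simp add: inner_axis)
qed

lemma measurable_vec_componentwise:
  fixes f :: "'a \<Rightarrow> 'b::euclidean_space^'n"
  assumes "\<And>i. (\<lambda>x. f x $ i) \<in> borel_measurable M"
  shows "f \<in> borel_measurable M"
proof (rule iffD2[OF borel_measurable_euclidean_space], safe)
  fix b :: "'b^'n" assume "b \<in> Basis"
  then obtain i u where "b = axis i u" "u \<in> Basis" by (auto simp: Basis_vec_def)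
  thus "(\<lambda>x. f x \<bullet> b) \<in> borel_measurable M"
    using assms[of i] by (simp add: inner_axis)
qed

lemma locally_integrable_bounded:
  fixes f :: "'a::euclidean_space \<Rightarrow> 'b::euclidean_space"
  assumes "f \<in> borel_measurable borel" "continuous_on UNIV h" "\<And>x. norm (f x) \<le> h x"
  shows "locally_integrable f"
  unfolding locally_integrable_def
proof safe
  fix K :: "'a set" assume K: "compact K"
  have [measurable]: "f \<in> borel_measurable borel" "K \<in> sets borel"
    using assms(1) borel_closed[OF compact_imp_closed[OF K]] by auto
  have "set_integrable lborel K h"
    unfolding set_integrable_def
    by (rule borel_integrable_compact[OF K continuous_on_subset[OF assms(2)]]) simp
  thus "set_integrable lborel K f"
    unfolding set_integrable_def
  proof (rule Bochner_Integration.integrable_bound)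
    show "(\<lambda>x. indicat_real K x *\<^sub>R f x) \<in> borel_measurable lborel"
      by measurable
    show "AE x in lborel. norm (indicat_real K x *\<^sub>R f x) \<le> norm (indicat_real K x *\<^sub>R h x)"
      using order_trans[OF assms(3) abs_ge_self] by (auto simp: indicator_def)
  qed
qed (use assms in simp)

lemma has_weak_gradient_classical:
  fixes f :: "real^'n \<Rightarrow> real^'m"
  assumes "\<And>i. has_gradient (\<lambda>x. f x $ i) (\<lambda>x. G x $ i)"
  shows "has_weak_gradient f G"
proof -
  have "continuous_on UNIV (\<lambda>x. \<chi> i. f x $ i)" "continuous_on UNIV (\<lambda>x. \<chi> i. G x $ i)"
    by (rule continuous_on_vec_lambda, use has_gradient_continuous[OF assms] assms in \<open>simp add: has_gradient_def\<close>)+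
  hence c: "continuous_on UNIV f" "continuous_on UNIV G" by simp_all
  have "locally_integrable f" "locally_integrable G"
    by (rule locally_integrable_bounded[OF _ continuous_on_norm[OF c(1)]];
        use c in \<open>simp add: borel_measurable_continuous_onI\<close>)
       (rule locally_integrable_bounded[OF _ continuous_on_norm[OF c(2)]];
        use c in \<open>simp add: borel_measurable_continuous_onI\<close>)
  thus ?thesis unfolding has_weak_gradient_def
    using integral_gradient_test_function[OF _ assms] by auto
qed

lemma continuous_in_L2_loc:
  fixes f :: "'a::euclidean_space \<Rightarrow> 'b::euclidean_space"
  assumes "continuous_on UNIV f"
  shows "f \<in> L2_loc"
proof -
  have "locally_integrable (\<lambda>x. (norm (f x))\<^sup>2)"
    by (rule locally_integrable_bounded[where h="\<lambda>x. (norm (f x))\<^sup>2"])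
       (use assms in \<open>auto intro!: borel_measurable_continuous_onI continuous_intros\<close>)
  thus ?thesis using assms by (auto simp: L2_loc_def locally_integrable_def borel_measurable_continuous_onI)
qed

section \<open>The profile: a linear strain flow\<close>

text \<open>The rates are \<open>1/2 - \<epsilon>, 1/2 - \<epsilon>, - 1 + 2 \<epsilon>\<close> with \<open>\<epsilon> = 1/20\<close>. All of them are below \<open>1/2\<close>, so that the
  drift \<open>U - \<xi>/2\<close> contracts towards the origin; the strong vertical compression is the source of the
  instability.\<close>

definition strain :: "real^3" where "strain = vector [9/20, 9/20, - 9/10]"

definition strain_flow :: "real^3 \<Rightarrow> real^3" where "strain_flow x = (\<chi> i. strain $ i * x $ i)"

definition strain_gradient :: "real^3^3" where
  "strain_gradient = (\<chi> i. axis i (strain $ i))"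

lemma strain_simps [simp]: "strain $ 1 = 9/20" "strain $ 2 = 9/20" "strain $ 3 = - 9/10"
  by (simp_all add: strain_def)

lemma has_gradient_coordinate: "has_gradient (\<lambda>x::real^'n. c * x $ i) (\<lambda>x. axis i c)"
  unfolding has_gradient_def
  by (auto intro!: bounded_linear.has_derivative[OF bounded_linear_vec_nth] derivative_eq_intros simp: inner_axis' )

lemma strain_flow_weak_gradient: "has_weak_gradient strain_flow (\<lambda>x. strain_gradient)"
  by (rule has_weak_gradient_classical)
     (simp add: strain_flow_def strain_gradient_def has_gradient_coordinate)

lemma strain_gradient_mult: "strain_gradient *v w = (\<chi> i. strain $ i * w $ i)"
proof -
  have "(\<Sum>j\<in>UNIV. axis i c $ j * w $ j) = c * w $ i" for i :: 3 and c
    by (simp add: axis_def if_distrib[where f="\<lambda>a. a * _"] sum.delta' cong: if_cong)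
  thus ?thesis by (simp add: strain_gradient_def matrix_vector_mult_def vec_eq_iff)
qed

lemma strain_flow_H1_loc: "strain_flow \<in> H1_loc"
proof -
  have "continuous_on UNIV strain_flow"
    unfolding strain_flow_def by (intro continuous_on_vec_lambda continuous_intros)
  thus ?thesis
    using strain_flow_weak_gradient continuous_in_L2_loc[of strain_flow]
      continuous_in_L2_loc[of "\<lambda>x::real^3. strain_gradient"]
    by (auto simp: H1_loc_def)
qed

lemma strain_flow_divergence_free: "weakly_divergence_free strain_flow"
  unfolding weakly_divergence_free_def
  using strain_flow_weak_gradient
  by (auto simp: trace_def strain_gradient_def sum_3 intro!: exI[of _ "\<lambda>x. strain_gradient"])

text \<open>The flow is linear with a symmetric matrix \<open>A\<close>, so the inertial and self-similar terms add up to
  \<open>(A\<^sup>2 - A) \<xi>\<close>, a gradient, and are absorbed by the pressure.\<close>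

lemma strain_flow_profile: "weak_profile_equation strain_flow"
  unfolding weak_profile_equation_def
proof (intro exI[of _ "\<lambda>x. strain_gradient"] conjI allI impI strain_flow_weak_gradient)
  fix \<phi> :: "real^3 \<Rightarrow> real^3" assume \<phi>: "solenoidal_test_field \<phi>"
  hence t: "test_function \<phi>" by (simp add: solenoidal_test_field_def)
  define c where "c = (\<lambda>i. (strain $ i)\<^sup>2 - strain $ i)"
  have grad: "has_gradient (\<lambda>x. \<Sum>i\<in>UNIV. c i / 2 * (x $ i)\<^sup>2) (\<lambda>x. \<chi> i. c i * x $ i)"
  proof -
    have "((\<lambda>x. \<Sum>i\<in>UNIV. c i / 2 * (x $ i)\<^sup>2) has_derivative (\<lambda>h. \<Sum>i\<in>UNIV. c i / 2 * (of_nat 2 * h $ i * (x $ i) ^ (2 - 1)))) (at x)" for x :: "real^3"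
      by (intro has_derivative_sum has_derivative_mult_right has_derivative_power
          bounded_linear.has_derivative[OF bounded_linear_vec_nth] has_derivative_ident)
    moreover have "(\<lambda>h. (\<chi> i. c i * x $ i) \<bullet> h) = (\<lambda>h. \<Sum>i\<in>UNIV. c i / 2 * (of_nat 2 * h $ i * (x $ i) ^ (2 - 1)))" for x :: "real^3"
      by (simp add: inner_vec_def mult_ac)
    ultimately show ?thesis unfolding has_gradient_def
      by (simp add: continuous_on_vec_lambda continuous_on_mult_left continuous_on_component continuous_on_id)
  qed
  have one: "has_gradient (\<lambda>x::real^3. k) (\<lambda>x. 0)" for k
    by (simp add: has_gradient_def)
  have J: "integrable lborel (\<lambda>x. strain $ i * jacobian_at \<phi> x $ i $ i)"
    "(\<integral>x. strain $ i * jacobian_at \<phi> x $ i $ i \<partial>lborel) = 0" for i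
    using integral_gradient_test_field[OF t one, of "strain $ i" i i] test_field_integrable(2)[OF t continuous_on_const]
    by simp_all
  have P: "integrable lborel (\<lambda>x. (c i * x $ i) * \<phi> x $ i)" for i
    by (rule test_field_integrable[OF t]) (intro continuous_intros)
  have "(\<integral>x. (- (1/2) *\<^sub>R strain_flow x - (1/2) *\<^sub>R (strain_gradient *v x) + strain_gradient *v strain_flow x) \<bullet> \<phi> x
      + strain_gradient \<bullet> jacobian_at \<phi> x \<partial>lborel)
    = (\<integral>x. (\<Sum>i\<in>UNIV. (c i * x $ i) * \<phi> x $ i) + (\<Sum>i\<in>UNIV. strain $ i * jacobian_at \<phi> x $ i $ i) \<partial>lborel)"
  proof (rule Bochner_Integration.integral_cong[OF refl])
    fix x :: "real^3"
    have "(- (1/2) *\<^sub>R strain_flow x - (1/2) *\<^sub>R (strain_gradient *v x) + strain_gradient *v strain_flow x) \<bullet> \<phi> x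
        = (\<Sum>i\<in>UNIV. (c i * x $ i) * \<phi> x $ i)"
      unfolding strain_gradient_mult inner_vec_def
      by (intro sum.cong refl) (simp add: strain_flow_def c_def power2_eq_square algebra_simps)
    moreover have "strain_gradient \<bullet> jacobian_at \<phi> x = (\<Sum>i\<in>UNIV. strain $ i * jacobian_at \<phi> x $ i $ i)"
      unfolding inner_vec_def[of strain_gradient] by (simp add: strain_gradient_def inner_axis')
    ultimately show "(- (1/2) *\<^sub>R strain_flow x - (1/2) *\<^sub>R (strain_gradient *v x) + strain_gradient *v strain_flow x) \<bullet> \<phi> x
      + strain_gradient \<bullet> jacobian_at \<phi> x = (\<Sum>i\<in>UNIV. (c i * x $ i) * \<phi> x $ i) + (\<Sum>i\<in>UNIV. strain $ i * jacobian_at \<phi> x $ i $ i)"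
      by simp
  qed
  also have "\<dots> = (\<integral>x. (\<Sum>i\<in>UNIV. (c i * x $ i) * \<phi> x $ i) \<partial>lborel) + (\<integral>x. (\<Sum>i\<in>UNIV. strain $ i * jacobian_at \<phi> x $ i $ i) \<partial>lborel)"
    by (intro Bochner_Integration.integral_add Bochner_Integration.integrable_sum P J)
  also have "(\<integral>x. (\<Sum>i\<in>UNIV. (c i * x $ i) * \<phi> x $ i) \<partial>lborel) = 0"
    using integral_gradient_solenoidal[OF \<phi> grad] by simp
  also have "(\<integral>x. (\<Sum>i\<in>UNIV. strain $ i * jacobian_at \<phi> x $ i $ i) \<partial>lborel)
      = (\<Sum>i\<in>UNIV. \<integral>x. strain $ i * jacobian_at \<phi> x $ i $ i \<partial>lborel)"
    by (rule Bochner_Integration.integral_sum) (rule J(1))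
  also have "\<dots> = 0" by (simp only: J(2) sum.neutral_const)
  also have "0 + 0 = (0::real)" by simp
  finally show "(\<integral>x. (- (1/2) *\<^sub>R strain_flow x - (1/2) *\<^sub>R (strain_gradient *v x) + strain_gradient *v strain_flow x) \<bullet> \<phi> x
      + strain_gradient \<bullet> jacobian_at \<phi> x \<partial>lborel) = 0" .
qed

section \<open>The linearised operator on a single mode\<close>

text \<open>\<open>vel_mode 1\<close>, \<open>vel_mode 2\<close> and \<open>vel_mode 3\<close> are the components of \<open>curl (curl (G e\<^sub>3))\<close>. This is
  \<open>\<nabla> \<partial>\<^sub>3 G - \<Delta> G e\<^sub>3\<close>, hence up to constants the Leray projection of \<open>G e\<^sub>3\<close> once it is integrated over the
  heat flow time.\<close>

definition vel_mode :: "3 \<Rightarrow> real \<times> real \<Rightarrow> real^3 \<Rightarrow> real" where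
  "vel_mode i y x = (if i = 1 then mode 1 0 1 y x else if i = 2 then mode 0 1 1 y x
     else - (mode 2 0 0 y x + mode 0 2 0 y x))"

definition vel_grad :: "3 \<Rightarrow> real \<times> real \<Rightarrow> real^3 \<Rightarrow> real^3" where
  "vel_grad i y x =
     (if i = 1 then vector [mode 2 0 1 y x, mode 1 1 1 y x, mode 1 0 2 y x]
      else if i = 2 then vector [mode 1 1 1 y x, mode 0 2 1 y x, mode 0 1 2 y x]
      else - (vector [mode 3 0 0 y x, mode 2 1 0 y x, mode 2 0 1 y x]
              + vector [mode 1 2 0 y x, mode 0 3 0 y x, mode 0 2 1 y x]))"

text \<open>Since the matrix \<open>A\<close> of the strain is symmetric, the linearised operator maps \<open>\<nabla>f\<close> to the gradient
  of \<open>(A - 1/2) \<xi> \<cdot> \<nabla>f - \<Delta> f\<close>. This is that potential for \<open>f = \<partial>\<^sub>3 G\<close>, with the eigenvalue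
  subtracted.\<close>

definition pressure :: "real \<times> real \<Rightarrow> real^3 \<Rightarrow> real" where
  "pressure y x = \<bar>snd y\<bar> / 40 * (mode 2 0 1 y x + mode 0 2 1 y x)
     + 7/10 * (fst y ^ 16 + \<bar>snd y\<bar>) * mode 0 0 3 y x + 119/40 * mode 0 0 1 y x"

definition pressure_grad :: "real \<times> real \<Rightarrow> real^3 \<Rightarrow> real^3" where
  "pressure_grad y x = (\<bar>snd y\<bar> / 40) *\<^sub>R
       (vector [mode 3 0 1 y x, mode 2 1 1 y x, mode 2 0 2 y x] + vector [mode 1 2 1 y x, mode 0 3 1 y x, mode 0 2 2 y x])
     + (7/10 * (fst y ^ 16 + \<bar>snd y\<bar>)) *\<^sub>R vector [mode 1 0 3 y x, mode 0 1 3 y x, mode 0 0 4 y x]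
     + (119/40) *\<^sub>R vector [mode 1 0 1 y x, mode 0 1 1 y x, mode 0 0 2 y x]"

lemma has_gradient_mode_numeral:
  "has_gradient (mode 1 0 1 y) (\<lambda>x. vector [mode 2 0 1 y x, mode 1 1 1 y x, mode 1 0 2 y x])"
  "has_gradient (mode 0 1 1 y) (\<lambda>x. vector [mode 1 1 1 y x, mode 0 2 1 y x, mode 0 1 2 y x])"
  "has_gradient (mode 2 0 0 y) (\<lambda>x. vector [mode 3 0 0 y x, mode 2 1 0 y x, mode 2 0 1 y x])"
  "has_gradient (mode 0 2 0 y) (\<lambda>x. vector [mode 1 2 0 y x, mode 0 3 0 y x, mode 0 2 1 y x])"
  "has_gradient (mode 2 0 1 y) (\<lambda>x. vector [mode 3 0 1 y x, mode 2 1 1 y x, mode 2 0 2 y x])"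
  "has_gradient (mode 0 2 1 y) (\<lambda>x. vector [mode 1 2 1 y x, mode 0 3 1 y x, mode 0 2 2 y x])"
  "has_gradient (mode 0 0 3 y) (\<lambda>x. vector [mode 1 0 3 y x, mode 0 1 3 y x, mode 0 0 4 y x])"
  "has_gradient (mode 0 0 1 y) (\<lambda>x. vector [mode 1 0 1 y x, mode 0 1 1 y x, mode 0 0 2 y x])"
  using has_gradient_mode[of 1 0 1 y] has_gradient_mode[of 0 1 1 y] has_gradient_mode[of 2 0 0 y]
    has_gradient_mode[of 0 2 0 y] has_gradient_mode[of 2 0 1 y] has_gradient_mode[of 0 2 1 y]
    has_gradient_mode[of 0 0 3 y] has_gradient_mode[of 0 0 1 y]
  by (simp_all del: One_nat_def)

lemma has_gradient_vel_mode: "has_gradient (vel_mode i y) (vel_grad i y)"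
proof -
  have "vel_mode 1 y = mode 1 0 1 y" "vel_mode 2 y = mode 0 1 1 y"
    "vel_mode 3 y = (\<lambda>x. - (mode 2 0 0 y x + mode 0 2 0 y x))"
    by (auto simp: vel_mode_def fun_eq_iff simp del: One_nat_def)
  thus ?thesis
    using exhaust_3[of i] has_gradient_mode_numeral(1,2)[of y]
      has_gradient_uminus[OF has_gradient_add[OF has_gradient_mode_numeral(3,4)[of y]]]
    by (auto simp: vel_grad_def[abs_def] simp del: One_nat_def)
qed

lemma has_gradient_pressure: "has_gradient (pressure y) (pressure_grad y)"
  unfolding pressure_def[abs_def] pressure_grad_def[abs_def]
  by (intro has_gradient_add has_gradient_cmult has_gradient_mode_numeral)

definition vel_second_partial :: "3 \<Rightarrow> 3 \<Rightarrow> real \<times> real \<Rightarrow> real^3 \<Rightarrow> real" where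
  "vel_second_partial i j y x =
     (if i = 1 then (if j = 1 then mode 3 0 1 y x else if j = 2 then mode 1 2 1 y x else mode 1 0 3 y x)
      else if i = 2 then (if j = 1 then mode 2 1 1 y x else if j = 2 then mode 0 3 1 y x else mode 0 1 3 y x)
      else (if j = 1 then - (mode 4 0 0 y x + mode 2 2 0 y x)
            else if j = 2 then - (mode 2 2 0 y x + mode 0 4 0 y x)
            else - (mode 2 0 2 y x + mode 0 2 2 y x)))"

lemma vel_grad_differentiable:
  "\<exists>g. has_gradient (\<lambda>x. vel_grad i y x $ j) g \<and> (\<forall>x. g x $ j = vel_second_partial i j y x)"
proof -
  have single: "\<exists>g. has_gradient (\<lambda>x. mode a b c y x) g \<and> (\<forall>x. g x $ 1 = mode (a + 1) b c y x)"
    "\<exists>g. has_gradient (\<lambda>x. mode a b c y x) g \<and> (\<forall>x. g x $ 2 = mode a (b + 1) c y x)"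
    "\<exists>g. has_gradient (\<lambda>x. mode a b c y x) g \<and> (\<forall>x. g x $ 3 = mode a b (c + 1) y x)" for a b c
    by (rule exI, rule conjI, rule has_gradient_mode, simp)+
  have pair: "\<exists>g. has_gradient (\<lambda>x. - mode a b c y x - mode a' b' c' y x) g \<and> (\<forall>x. g x $ 1 = - mode (a + 1) b c y x - mode (a' + 1) b' c' y x)"
    "\<exists>g. has_gradient (\<lambda>x. - mode a b c y x - mode a' b' c' y x) g \<and> (\<forall>x. g x $ 2 = - mode a (b + 1) c y x - mode a' (b' + 1) c' y x)"
    "\<exists>g. has_gradient (\<lambda>x. - mode a b c y x - mode a' b' c' y x) g \<and> (\<forall>x. g x $ 3 = - mode a b (c + 1) y x - mode a' b' (c' + 1) y x)"
    for a b c a' b' c'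
    by (rule exI, rule conjI,
        rule has_gradient_add[OF has_gradient_uminus[OF has_gradient_mode[of a b c y]] has_gradient_uminus[OF has_gradient_mode[of a' b' c' y]], simplified], simp)+
  show ?thesis
    using exhaust_3[of i] exhaust_3[of j] single(1)[of 2 0 1] single(2)[of 1 1 1] single(3)[of 1 0 2]
      single(1)[of 1 1 1] single(2)[of 0 2 1] single(3)[of 0 1 2]
      pair(1)[of 3 0 0 1 2 0] pair(2)[of 2 1 0 0 3 0] pair(3)[of 2 0 1 0 2 1]
    by (elim disjE) (simp_all add: vel_grad_def vel_second_partial_def del: One_nat_def)
qed

lemma continuous_vel_grad: "continuous_on UNIV (\<lambda>x. vel_grad i y x $ j)"
  using vel_grad_differentiable[of i y j] has_gradient_continuous by blast

lemma continuous_mode: "continuous_on UNIV (mode a b c y)"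
  by (rule has_gradient_continuous[OF has_gradient_mode])

lemma continuous_vel_second_partial: "continuous_on UNIV (vel_second_partial i j y)"
  unfolding vel_second_partial_def[abs_def]
  by (cases "i = 1"; cases "i = 2"; cases "j = 1"; cases "j = 2")
     (auto intro!: continuous_intros continuous_mode simp del: One_nat_def)

text \<open>The heart of the matter: on one mode, the linearised operator minus the eigenvalue \<open>- 3/40\<close> is a
  gradient up to the residual in the third component. The recursion of the Gaussian derivatives
  removes every coordinate factor, and what remains is an identity between linear combinations of
  modes.\<close>

lemma linearized_operator_mode:
  "(strain $ i - 1/2 + 3/40) * vel_mode i y x + (\<Sum>j\<in>UNIV. (strain $ j - 1/2) * x $ j * vel_grad i y x $ j)
     - (\<Sum>j\<in>UNIV. vel_second_partial i j y x)
   = pressure_grad y x $ i - (if i = 3 then residual y x else 0)"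
proof -
  note r = mode_recursion[of _ x _ _ y]
  define \<tau> \<rho> where "\<tau> = \<bar>snd y\<bar>" and "\<rho> = fst y ^ 16"
  have w: "width_h y = 40 + \<tau>" "width_v y = 10/7 + \<rho> + \<tau>"
    by (simp_all add: width_h_def width_v_def \<tau>_def \<rho>_def)
  have assoc: "(strain $ j - 1/2) * x $ j * z = (strain $ j - 1/2) * (x $ j * z)" for j z by simp
  consider "i = 1" | "i = 2" | "i = 3" using exhaust_3[of i] by blast
  thus ?thesis
  proof cases
    case 1
    have "x $ 1 * mode 2 0 1 y x = - ((40 + \<tau>) / 2) * mode 3 0 1 y x - 2 * mode 1 0 1 y x"
      "x $ 2 * mode 1 1 1 y x = - ((40 + \<tau>) / 2) * mode 1 2 1 y x - mode 1 0 1 y x"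
      "x $ 3 * mode 1 0 2 y x = - ((10/7 + \<rho> + \<tau>) / 2) * mode 1 0 3 y x - 2 * mode 1 0 1 y x"
      using r(1)[of 2 0 1] r(2)[of 1 1 1] r(3)[of 2 1 0] unfolding w by (simp_all add: numeral_eq_Suc)
    note this [simp]
    show ?thesis unfolding 1 sum_3 assoc
      by (simp add: vel_mode_def vel_grad_def vel_second_partial_def pressure_grad_def \<tau>_def[symmetric] \<rho>_def[symmetric] del: One_nat_def)
         (simp add: field_simps del: One_nat_def)
  next
    case 2
    have "x $ 1 * mode 1 1 1 y x = - ((40 + \<tau>) / 2) * mode 2 1 1 y x - mode 0 1 1 y x"
      "x $ 2 * mode 0 2 1 y x = - ((40 + \<tau>) / 2) * mode 0 3 1 y x - 2 * mode 0 1 1 y x"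
      "x $ 3 * mode 0 1 2 y x = - ((10/7 + \<rho> + \<tau>) / 2) * mode 0 1 3 y x - 2 * mode 0 1 1 y x"
      using r(1)[of 1 1 1] r(2)[of 2 0 1] r(3)[of 2 0 1] unfolding w by (simp_all add: numeral_eq_Suc)
    note this [simp]
    show ?thesis unfolding 2 sum_3 assoc
      by (simp add: vel_mode_def vel_grad_def vel_second_partial_def pressure_grad_def \<tau>_def[symmetric] \<rho>_def[symmetric] del: One_nat_def)
         (simp add: field_simps del: One_nat_def)
  next
    case 3
    have e: "x $ 1 * mode 3 0 0 y x = - ((40 + \<tau>) / 2) * mode 4 0 0 y x - 3 * mode 2 0 0 y x"
      "x $ 1 * mode 1 2 0 y x = - ((40 + \<tau>) / 2) * mode 2 2 0 y x - mode 0 2 0 y x"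
      "x $ 2 * mode 2 1 0 y x = - ((40 + \<tau>) / 2) * mode 2 2 0 y x - mode 2 0 0 y x"
      "x $ 2 * mode 0 3 0 y x = - ((40 + \<tau>) / 2) * mode 0 4 0 y x - 3 * mode 0 2 0 y x"
      "x $ 3 * mode 2 0 1 y x = - ((10/7 + \<rho> + \<tau>) / 2) * mode 2 0 2 y x - mode 2 0 0 y x"
      "x $ 3 * mode 0 2 1 y x = - ((10/7 + \<rho> + \<tau>) / 2) * mode 0 2 2 y x - mode 0 2 0 y x"
      using r(1)[of 3 0 0] r(1)[of 1 2 0] r(2)[of 1 2 0] r(2)[of 3 0 0] r(3)[of 1 2 0] r(3)[of 1 0 2]
      unfolding w by (simp_all add: numeral_eq_Suc)
    have g: "x $ 1 * vel_grad 3 y x $ 1 = - (x $ 1 * mode 3 0 0 y x) - x $ 1 * mode 1 2 0 y x"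
      "x $ 2 * vel_grad 3 y x $ 2 = - (x $ 2 * mode 2 1 0 y x) - x $ 2 * mode 0 3 0 y x"
      "x $ 3 * vel_grad 3 y x $ 3 = - (x $ 3 * mode 2 0 1 y x) - x $ 3 * mode 0 2 1 y x"
      by (simp_all add: vel_grad_def algebra_simps del: One_nat_def)
    show ?thesis unfolding 3 sum_3 assoc g e
      by (simp add: vel_mode_def vel_second_partial_def pressure_grad_def residual_def \<tau>_def[symmetric] \<rho>_def[symmetric] del: One_nat_def)
         (simp add: field_simps del: One_nat_def)
  qed
qed

lemma integral_sum_add_sum:
  fixes f :: "'i::finite \<Rightarrow> 'a \<Rightarrow> real" and g :: "'i \<Rightarrow> 'j::finite \<Rightarrow> 'a \<Rightarrow> real"
  assumes "\<And>i. integrable M (f i)" "\<And>i j. integrable M (g i j)"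
  shows "(\<integral>x. (\<Sum>i\<in>UNIV. f i x + (\<Sum>j\<in>UNIV. g i j x)) \<partial>M)
    = (\<Sum>i\<in>UNIV. (\<integral>x. f i x \<partial>M) + (\<Sum>j\<in>UNIV. \<integral>x. g i j x \<partial>M))"
  using assms by (simp add: Bochner_Integration.integral_sum Bochner_Integration.integral_add)

lemma mode_weak_equation:
  assumes \<phi>: "solenoidal_test_field \<phi>"
  shows "(\<integral>x. (\<Sum>i\<in>UNIV. ((strain $ i - 1/2 + 3/40) * \<phi> x $ i) * vel_mode i y x
      + (\<Sum>j\<in>UNIV. ((strain $ j - 1/2) * x $ j * \<phi> x $ i + jacobian_at \<phi> x $ i $ j) * vel_grad i y x $ j)) \<partial>lborel)
    = - (\<integral>x. \<phi> x $ 3 * residual y x \<partial>lborel)"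
proof -
  have t: "test_function \<phi>" using \<phi> by (simp add: solenoidal_test_field_def)
  define A where "A = (\<lambda>i x. (strain $ i - 1/2 + 3/40) * vel_mode i y x
      + (\<Sum>j\<in>UNIV. (strain $ j - 1/2) * x $ j * vel_grad i y x $ j))"
  have cA: "continuous_on UNIV (A i)" for i
    unfolding A_def using has_gradient_continuous[OF has_gradient_vel_mode]
    by (intro continuous_intros continuous_vel_grad) auto
  have iA: "integrable lborel (\<lambda>x. A i x * \<phi> x $ i)" for i
    by (rule test_field_integrable[OF t cA])
  have iJ: "integrable lborel (\<lambda>x. vel_grad i y x $ j * jacobian_at \<phi> x $ i $ j)" for i j
    by (rule test_field_integrable[OF t continuous_vel_grad])
  have iS: "integrable lborel (\<lambda>x. vel_second_partial i j y x * \<phi> x $ i)" for i j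
    by (rule test_field_integrable[OF t continuous_vel_second_partial])
  have J: "(\<integral>x. vel_grad i y x $ j * jacobian_at \<phi> x $ i $ j \<partial>lborel) = (\<integral>x. - (vel_second_partial i j y x * \<phi> x $ i) \<partial>lborel)" for i j
  proof -
    obtain g where g: "has_gradient (\<lambda>x. vel_grad i y x $ j) g" "\<forall>x. g x $ j = vel_second_partial i j y x"
      using vel_grad_differentiable by blast
    show ?thesis using integral_gradient_test_field[OF t g(1), of i j] g(2) by simp
  qed
  have "(\<integral>x. (\<Sum>i\<in>UNIV. ((strain $ i - 1/2 + 3/40) * \<phi> x $ i) * vel_mode i y x
      + (\<Sum>j\<in>UNIV. ((strain $ j - 1/2) * x $ j * \<phi> x $ i + jacobian_at \<phi> x $ i $ j) * vel_grad i y x $ j)) \<partial>lborel)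
    = (\<integral>x. (\<Sum>i\<in>UNIV. A i x * \<phi> x $ i + (\<Sum>j\<in>UNIV. vel_grad i y x $ j * jacobian_at \<phi> x $ i $ j)) \<partial>lborel)"
    unfolding A_def
    by (intro Bochner_Integration.integral_cong refl sum.cong)
       (simp add: sum_3 algebra_simps)
  also have "\<dots> = (\<Sum>i\<in>UNIV. (\<integral>x. A i x * \<phi> x $ i \<partial>lborel) + (\<Sum>j\<in>UNIV. \<integral>x. vel_grad i y x $ j * jacobian_at \<phi> x $ i $ j \<partial>lborel))"
    by (rule integral_sum_add_sum[OF iA iJ])
  also have "\<dots> = (\<Sum>i\<in>UNIV. (\<integral>x. A i x * \<phi> x $ i \<partial>lborel) + (\<Sum>j\<in>UNIV. \<integral>x. - (vel_second_partial i j y x * \<phi> x $ i) \<partial>lborel))"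
    by (simp only: J)
  also have "\<dots> = (\<integral>x. (\<Sum>i\<in>UNIV. A i x * \<phi> x $ i + (\<Sum>j\<in>UNIV. - (vel_second_partial i j y x * \<phi> x $ i))) \<partial>lborel)"
    by (rule integral_sum_add_sum[OF iA, symmetric]) (use iS in simp)
  also have "\<dots> = (\<integral>x. (\<Sum>i\<in>UNIV. pressure_grad y x $ i * \<phi> x $ i) - \<phi> x $ 3 * residual y x \<partial>lborel)"
  proof (intro Bochner_Integration.integral_cong refl)
    fix x
    have "(\<Sum>i\<in>UNIV. A i x * \<phi> x $ i + (\<Sum>j\<in>UNIV. - (vel_second_partial i j y x * \<phi> x $ i)))
       = (\<Sum>i\<in>UNIV. (pressure_grad y x $ i - (if i = 3 then residual y x else 0)) * \<phi> x $ i)"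
      unfolding linearized_operator_mode[symmetric] A_def
      by (intro sum.cong refl) (simp add: sum_negf sum_distrib_right left_diff_distrib)
    also have "\<dots> = (\<Sum>i\<in>UNIV. pressure_grad y x $ i * \<phi> x $ i) - \<phi> x $ 3 * residual y x"
      by (simp add: sum_3 algebra_simps)
    finally show "(\<Sum>i\<in>UNIV. A i x * \<phi> x $ i + (\<Sum>j\<in>UNIV. - (vel_second_partial i j y x * \<phi> x $ i)))
       = (\<Sum>i\<in>UNIV. pressure_grad y x $ i * \<phi> x $ i) - \<phi> x $ 3 * residual y x" .
  qed
  also have "\<dots> = (\<integral>x. (\<Sum>i\<in>UNIV. pressure_grad y x $ i * \<phi> x $ i) \<partial>lborel) - (\<integral>x. \<phi> x $ 3 * residual y x \<partial>lborel)"
  proof (rule Bochner_Integration.integral_diff)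
    have "continuous_on UNIV (\<lambda>x. pressure_grad y x $ i)" for i
      using has_gradient_pressure[of y] by (simp add: has_gradient_def continuous_on_component)
    thus "integrable lborel (\<lambda>x. \<Sum>i\<in>UNIV. pressure_grad y x $ i * \<phi> x $ i)"
      by (intro Bochner_Integration.integrable_sum test_field_integrable[OF t])
    show "integrable lborel (\<lambda>x. \<phi> x $ 3 * residual y x)"
      using test_field_integrable(1)[OF t superposable_continuous_slices(1)[OF superposable_residual]]
      by (simp add: mult.commute)
  qed
  also have "(\<integral>x. (\<Sum>i\<in>UNIV. pressure_grad y x $ i * \<phi> x $ i) \<partial>lborel) = 0"
    by (rule integral_gradient_solenoidal[OF \<phi> has_gradient_pressure])
  finally show ?thesis by simp
qed

section \<open>The eigenfield\<close>

definition eigenfield :: "real^3 \<Rightarrow> real^3" where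
  "eigenfield x = (\<chi> i. superposition (vel_mode i) x)"

definition eigenfield_grad :: "real^3 \<Rightarrow> real^3^3" where
  "eigenfield_grad x = (\<chi> i j. superposition (\<lambda>y x. vel_grad i y x $ j) x)"

lemma superposable_vel_mode: "superposable (vel_mode i)"
proof -
  have "superposable (\<lambda>y x. mode 1 0 1 y x)" "superposable (\<lambda>y x. mode 0 1 1 y x)"
    "superposable (\<lambda>y x. - (mode 2 0 0 y x + mode 0 2 0 y x))"
    by (intro superposable_uminus superposable_add superposable_mode; simp)+
  thus ?thesis
    by (cases "i = 1"; cases "i = 2") (simp_all add: vel_mode_def[abs_def] del: One_nat_def)
qed

lemma superposable_vel_grad: "superposable (\<lambda>y x. vel_grad i y x $ j)"
proof -
  have s: "superposable (\<lambda>y x. mode a b c y x)" if "2 \<le> a + b + c" for a b c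
    using superposable_mode[OF that] .
  have p: "superposable (\<lambda>y x. - mode a b c y x - mode a' b' c' y x)" if "2 \<le> a + b + c" "2 \<le> a' + b' + c'" for a b c a' b' c'
    using that by (intro superposable_uminus superposable_diff superposable_mode)
  show ?thesis
    using exhaust_3[of i] exhaust_3[of j] s[of 2 0 1] s[of 1 1 1] s[of 1 0 2] s[of 0 2 1] s[of 0 1 2]
      p[of 3 0 0 1 2 0] p[of 2 1 0 0 3 0] p[of 2 0 1 0 2 1]
    by (elim disjE) (simp_all add: vel_grad_def del: One_nat_def)
qed

definition enveloped :: "(real^3 \<Rightarrow> 'b::euclidean_space) \<Rightarrow> bool" where
  "enveloped f \<longleftrightarrow> f \<in> borel_measurable borel \<and> (\<exists>C\<ge>0. \<forall>x. norm (f x) \<le> C * envelope x)"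

lemma enveloped_superposition: "superposable F \<Longrightarrow> enveloped (superposition F)"
  unfolding enveloped_def
  by (metis real_norm_def superposition_bound superposition_measurable)

lemma enveloped_vec:
  fixes f :: "real^3 \<Rightarrow> 'b::euclidean_space^'n"
  assumes "\<And>i. enveloped (\<lambda>x. f x $ i)"
  shows "enveloped f"
proof -
  have "\<forall>i. \<exists>C\<ge>0. \<forall>x. norm (f x $ i) \<le> C * envelope x" using assms by (simp add: enveloped_def)
  then obtain C where C: "\<forall>i. C i \<ge> 0 \<and> (\<forall>x. norm (f x $ i) \<le> C i * envelope x)" by metis
  have "norm (f x) \<le> (\<Sum>i\<in>UNIV. C i) * envelope x" for x
  proof -
    have "norm (f x) \<le> (\<Sum>i\<in>UNIV. norm (f x $ i))"
      unfolding norm_vec_def by (rule L2_set_le_sum) simp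
    also have "\<dots> \<le> (\<Sum>i\<in>UNIV. C i * envelope x)" using C by (intro sum_mono) blast
    finally show ?thesis by (simp add: sum_distrib_right)
  qed
  moreover have "(\<Sum>i\<in>UNIV. C i) \<ge> 0" using C by (intro sum_nonneg) blast
  moreover have "f \<in> borel_measurable borel"
    using assms by (intro measurable_vec_componentwise) (simp add: enveloped_def)
  ultimately show ?thesis unfolding enveloped_def by blast
qed

lemma enveloped_L2:
  assumes "enveloped f"
  shows "f \<in> L2"
proof -
  obtain C where C: "C \<ge> 0" "\<forall>x. norm (f x) \<le> C * envelope x" using assms unfolding enveloped_def by blast
  have m [measurable]: "f \<in> borel_measurable borel" using assms by (simp add: enveloped_def)
  have "integrable lborel (\<lambda>x::real^3. C\<^sup>2 * (envelope x)\<^sup>2)"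
    by (intro integrable_mult_right integrable_envelope_square)
  hence "integrable lborel (\<lambda>x. (norm (f x))\<^sup>2)"
  proof (rule Bochner_Integration.integrable_bound)
    show "AE x in lborel. norm ((norm (f x))\<^sup>2) \<le> norm (C\<^sup>2 * (envelope x)\<^sup>2)"
      using C(2) by (intro AE_I2) (simp add: power_mono flip: power_mult_distrib)
  qed simp
  thus ?thesis by (simp add: L2_def)
qed

lemma enveloped_locally_integrable:
  assumes "enveloped f"
  shows "locally_integrable f"
proof -
  obtain C where C: "C \<ge> 0" "\<forall>x. norm (f x) \<le> C * envelope x" using assms unfolding enveloped_def by blast
  show ?thesis
    by (rule locally_integrable_bounded[where h="\<lambda>x. C * envelope x"])
       (use assms C in \<open>auto simp: enveloped_def intro!: continuous_intros continuous_on_envelope\<close>)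
qed

lemma enveloped_eigenfield: "enveloped eigenfield" "enveloped eigenfield_grad"
proof -
  show "enveloped eigenfield"
    by (rule enveloped_vec) (simp add: eigenfield_def enveloped_superposition superposable_vel_mode)
  show "enveloped eigenfield_grad"
    by (rule enveloped_vec, rule enveloped_vec)
       (simp add: eigenfield_grad_def enveloped_superposition superposable_vel_grad)
qed

lemma eigenfield_weak_gradient: "has_weak_gradient eigenfield eigenfield_grad"
  unfolding has_weak_gradient_def
proof (intro conjI allI impI enveloped_locally_integrable enveloped_eigenfield)
  fix \<psi> :: "real^3 \<Rightarrow> real" and i j :: 3
  assume \<psi>: "test_function \<psi>"
  obtain K where K: "compact K" "\<And>x. x \<notin> K \<Longrightarrow> \<psi> x = 0"
    by (rule test_function_compact_support[OF \<psi>]) (rule that)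
  have K': "frechet_derivative \<psi> (at x) (axis j 1) = 0" if "x \<notin> K" for x
    using derivative_eq_0_outside[OF test_function_derivative[OF \<psi>] compact_imp_closed[OF K(1)] K(2) that] by simp
  have c: "continuous_on UNIV \<psi>"
    using test_function_derivative[OF \<psi>]
    by (meson continuous_at_imp_continuous_on has_derivative_continuous)
  have "(\<integral>x. frechet_derivative \<psi> (at x) (axis j 1) * superposition (vel_mode i) x \<partial>lborel)
      = (\<integral>y. (\<integral>x. frechet_derivative \<psi> (at x) (axis j 1) * vel_mode i y x \<partial>lborel) \<partial>lborel)"
    by (rule superposition_Fubini(4)[OF superposable_vel_mode test_function_continuous_derivative[OF \<psi>] K(1) K'])
  also have "\<dots> = (\<integral>y. - (\<integral>x. \<psi> x * vel_grad i y x $ j \<partial>lborel) \<partial>lborel)"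
    using integral_gradient_test_function[OF \<psi> has_gradient_vel_mode, of i _ j] by (simp add: mult.commute)
  also have "\<dots> = - (\<integral>x. \<psi> x * superposition (\<lambda>y x. vel_grad i y x $ j) x \<partial>lborel)"
    using superposition_Fubini(4)[OF superposable_vel_grad c K, of i j] by simp
  finally show "(\<integral>x. eigenfield x $ i * frechet_derivative \<psi> (at x) (axis j 1) \<partial>lborel)
      = - (\<integral>x. eigenfield_grad x $ i $ j * \<psi> x \<partial>lborel)"
    by (simp add: eigenfield_def eigenfield_grad_def mult.commute)
qed

lemma eigenfield_H1: "eigenfield \<in> H1"
  unfolding H1_def
  using eigenfield_weak_gradient enveloped_L2[OF enveloped_eigenfield(1)] enveloped_L2[OF enveloped_eigenfield(2)]
  by blast

lemma eigenfield_divergence_free: "weakly_divergence_free eigenfield"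
proof -
  have "trace (eigenfield_grad x) = 0" for x
  proof -
    have "trace (eigenfield_grad x) = (\<Sum>i\<in>UNIV. superposition (\<lambda>y x. vel_grad i y x $ i) x)"
      by (simp add: trace_def eigenfield_grad_def)
    also have "\<dots> = (\<integral>y. (\<Sum>i\<in>UNIV. vel_grad i y x $ i) \<partial>lborel)"
      unfolding superposition_def
      by (rule Bochner_Integration.integral_sum[symmetric]) (rule superposable_integrable[OF superposable_vel_grad])
    also have "\<dots> = 0" by (simp add: sum_3 vel_grad_def)
    finally show ?thesis .
  qed
  thus ?thesis unfolding weakly_divergence_free_def using eigenfield_weak_gradient by auto
qed

text \<open>Near the origin every mode is positive in the third component, whatever its widths, so that no
  cancellation can occur in the superposition.\<close>

lemma vel_mode_3_positive:
  assumes "norm x < 1"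
  shows "vel_mode 3 y x > 0"
proof -
  have h2: "gauss_deriv 2 P s < 0" if "P \<ge> 40" "\<bar>s\<bar> < 1" for P s :: real
  proof -
    have "s\<^sup>2 < 1" using that(2) by (simp add: abs_square_less_1)
    hence "2 * s\<^sup>2 / P < 1" using that(1) by (simp add: divide_less_eq)
    moreover have "gauss_deriv 2 P s = - (2 / P * gauss_deriv 0 P s * (1 - 2 * s\<^sup>2 / P))"
      by (simp add: numeral_2_eq_2 power2_eq_square field_simps del: gauss_deriv.simps(1))
    moreover have "gauss_deriv 0 P s > 0" using that(1) by simp
    ultimately show ?thesis using that(1) by (simp del: gauss_deriv.simps add: zero_less_mult_iff)
  qed
  have P: "width_h y \<ge> 40" by (simp add: width_h_def)
  have pos: "gauss_deriv 0 (width_h y) s > 0" "gauss_deriv 0 (width_v y) s > 0" for s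
    using width_h_ge[of y] width_v_ge[of y] by simp_all
  have x: "\<bar>x $ i\<bar> < 1" for i using assms component_le_norm_cart[of x i] by linarith
  have "mode 2 0 0 y x < 0" "mode 0 2 0 y x < 0"
    using h2[OF P x[of 1]] h2[OF P x[of 2]] pos
    by (simp_all add: mode_def gauss3_def mult_less_0_iff del: gauss_deriv.simps)
  thus ?thesis by (simp add: vel_mode_def)
qed

lemma eigenfield_nonzero: "\<not> (AE x in lborel. eigenfield x = 0)"
proof
  assume ae: "AE x in lborel. eigenfield x = 0"
  have nz: "eigenfield x \<noteq> 0" if x: "norm x < 1" for x
  proof
    assume "eigenfield x = 0"
    hence "(\<integral>y. vel_mode 3 y x \<partial>lborel) = 0"
      by (metis eigenfield_def superposition_def vec_lambda_beta zero_index)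
    moreover have "AE y in lborel. 0 \<le> vel_mode 3 y x"
      using vel_mode_3_positive[OF x] by (simp add: less_imp_le)
    ultimately have "AE y in lborel. vel_mode 3 y x = 0"
      using integral_nonneg_eq_0_iff_AE[OF superposable_integrable[OF superposable_vel_mode]] by blast
    hence "AE y in (lborel :: (real \<times> real) measure). False"
      by eventually_elim (use vel_mode_3_positive[OF x] in \<open>metis less_irrefl\<close>)
    hence "emeasure (lborel :: (real \<times> real) measure) (space lborel) = 0"
      by (simp only: eventually_False ae_filter_eq_bot_iff)
    thus False by simp
  qed
  have "AE x in lborel. x \<notin> ball (0::real^3) 1"
    using ae by eventually_elim (use nz in \<open>auto simp: dist_norm\<close>)
  hence "{x \<in> space lborel. \<not> (x \<notin> ball (0::real^3) 1)} \<in> null_sets lborel"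
    by (subst (asm) AE_iff_null) auto
  hence "emeasure lborel (ball (0::real^3) 1) = 0" by (simp add: null_sets_def ball_def)
  thus False using content_ball_pos[of 1 "0::real^3"] by (simp add: measure_def)
qed

text \<open>Fubini's theorem moves the average over the parameters outside, where each mode contributes only
  its residual; moved back inside, the residuals average to zero at every point.\<close>

lemma eigenfield_equation: "weak_eigenvalue_equation strain_flow eigenfield (- 3/40)"
  unfolding weak_eigenvalue_equation_def
proof (rule exI[of _ "\<lambda>x. strain_gradient"], rule exI[of _ eigenfield_grad],
    intro conjI allI impI strain_flow_weak_gradient eigenfield_weak_gradient)
  fix \<phi> :: "real^3 \<Rightarrow> real^3" assume \<phi>: "solenoidal_test_field \<phi>"
  hence t: "test_function \<phi>" by (simp add: solenoidal_test_field_def)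
  obtain K where K: "compact K" "\<And>x i. x \<notin> K \<Longrightarrow> \<phi> x $ i = 0"
    "\<And>x i j. x \<notin> K \<Longrightarrow> jacobian_at \<phi> x $ i $ j = 0"
    by (rule test_field_compact_support[OF t]) (rule that)
  define c where "c = (\<lambda>i x. (strain $ i - 1/2 + 3/40) * \<phi> x $ i)"
  define d where "d = (\<lambda>i j x. (strain $ j - 1/2) * x $ j * \<phi> x $ i + jacobian_at \<phi> x $ i $ j)"
  let ?v = "\<lambda>i. superposition (vel_mode i)" and ?D = "\<lambda>i j. superposition (\<lambda>y x. vel_grad i y x $ j)"
  have cc: "continuous_on UNIV (c i)" and cd: "continuous_on UNIV (d i j)" for i j
    unfolding c_def d_def
    by (intro continuous_intros test_field_continuous[OF t] test_field_component(2)[OF t])+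
  have c0: "c i x = 0" and d0: "d i j x = 0" if "x \<notin> K" for i j x
    using K(2,3) that by (simp_all add: c_def d_def)
  have Fv: "integrable lborel (\<lambda>x. c i x * ?v i x)" "integrable lborel (\<lambda>x. c i x * vel_mode i y x)"
    "integrable lborel (\<lambda>y. \<integral>x. c i x * vel_mode i y x \<partial>lborel)"
    "(\<integral>x. c i x * ?v i x \<partial>lborel) = (\<integral>y. (\<integral>x. c i x * vel_mode i y x \<partial>lborel) \<partial>lborel)" for i y
    by (rule superposition_Fubini[OF superposable_vel_mode cc K(1)], erule c0)+
  have FD: "integrable lborel (\<lambda>x. d i j x * ?D i j x)" "integrable lborel (\<lambda>x. d i j x * vel_grad i y x $ j)"
    "integrable lborel (\<lambda>y. \<integral>x. d i j x * vel_grad i y x $ j \<partial>lborel)"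
    "(\<integral>x. d i j x * ?D i j x \<partial>lborel) = (\<integral>y. (\<integral>x. d i j x * vel_grad i y x $ j \<partial>lborel) \<partial>lborel)" for i j y
    by (rule superposition_Fubini[OF superposable_vel_grad cd K(1)], erule d0)+
  have Fr: "(\<integral>x. \<phi> x $ 3 * superposition residual x \<partial>lborel) = (\<integral>y. (\<integral>x. \<phi> x $ 3 * residual y x \<partial>lborel) \<partial>lborel)"
    by (rule superposition_Fubini[OF superposable_residual test_field_continuous[OF t] K(1)], erule K(2))
  define A where "A = (\<lambda>x. \<Sum>i\<in>UNIV. c i x * ?v i x + (\<Sum>j\<in>UNIV. d i j x * ?D i j x))"
  have iA: "integrable lborel A"
    unfolding A_def by (intro Bochner_Integration.integrable_sum Bochner_Integration.integrable_add Fv FD)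
  have "(\<integral>x. A x \<partial>lborel) = (\<Sum>i\<in>UNIV. (\<integral>x. c i x * ?v i x \<partial>lborel) + (\<Sum>j\<in>UNIV. \<integral>x. d i j x * ?D i j x \<partial>lborel))"
    unfolding A_def by (rule integral_sum_add_sum[OF Fv(1) FD(1)])
  also have "\<dots> = (\<Sum>i\<in>UNIV. (\<integral>y. (\<integral>x. c i x * vel_mode i y x \<partial>lborel) \<partial>lborel)
      + (\<Sum>j\<in>UNIV. \<integral>y. (\<integral>x. d i j x * vel_grad i y x $ j \<partial>lborel) \<partial>lborel))"
    by (simp only: Fv(4) FD(4))
  also have "\<dots> = (\<integral>y. (\<Sum>i\<in>UNIV. (\<integral>x. c i x * vel_mode i y x \<partial>lborel)
      + (\<Sum>j\<in>UNIV. \<integral>x. d i j x * vel_grad i y x $ j \<partial>lborel)) \<partial>lborel)"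
    by (rule integral_sum_add_sum[OF Fv(3) FD(3), symmetric])
  also have "\<dots> = (\<integral>y. (\<integral>x. (\<Sum>i\<in>UNIV. c i x * vel_mode i y x + (\<Sum>j\<in>UNIV. d i j x * vel_grad i y x $ j)) \<partial>lborel) \<partial>lborel)"
    by (simp only: integral_sum_add_sum[OF Fv(2) FD(2)])
  also have "\<dots> = (\<integral>y. - (\<integral>x. \<phi> x $ 3 * residual y x \<partial>lborel) \<partial>lborel)"
    unfolding c_def d_def by (simp only: mode_weak_equation[OF \<phi>])
  also have "\<dots> = - (\<integral>x. \<phi> x $ 3 * superposition residual x \<partial>lborel)"
    by (simp add: Fr)
  also have "\<dots> = 0" by (simp add: superposition_residual_eq_0)
  finally have A0: "(\<integral>x. A x \<partial>lborel) = 0" .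
  have iv: "integrable lborel (\<lambda>x. (- 3/40) * (\<Sum>i\<in>UNIV. \<phi> x $ i * ?v i x))"
    by (intro integrable_mult_right Bochner_Integration.integrable_sum
        superposition_Fubini(1)[OF superposable_vel_mode test_field_continuous[OF t] K(1) K(2)])
  have rhs: "(\<integral>x. ((- 3/40) *\<^sub>R eigenfield x) \<bullet> \<phi> x \<partial>lborel) = (\<integral>x. (- 3/40) * (\<Sum>i\<in>UNIV. \<phi> x $ i * ?v i x) \<partial>lborel)"
    by (intro Bochner_Integration.integral_cong refl)
       (simp add: inner_vec_def eigenfield_def sum_3 algebra_simps)
  have "(\<integral>x. (- (1/2) *\<^sub>R eigenfield x - (1/2) *\<^sub>R (eigenfield_grad x *v x)
          + (eigenfield_grad x *v strain_flow x + strain_gradient *v eigenfield x)) \<bullet> \<phi> x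
          + eigenfield_grad x \<bullet> jacobian_at \<phi> x \<partial>lborel)
      = (\<integral>x. A x + (- 3/40) * (\<Sum>i\<in>UNIV. \<phi> x $ i * ?v i x) \<partial>lborel)"
  proof (intro Bochner_Integration.integral_cong refl)
    fix x
    show "(- (1/2) *\<^sub>R eigenfield x - (1/2) *\<^sub>R (eigenfield_grad x *v x)
          + (eigenfield_grad x *v strain_flow x + strain_gradient *v eigenfield x)) \<bullet> \<phi> x
          + eigenfield_grad x \<bullet> jacobian_at \<phi> x
      = A x + (- 3/40) * (\<Sum>i\<in>UNIV. \<phi> x $ i * ?v i x)"
      unfolding strain_gradient_mult
      by (simp add: inner_vec_def sum_3 matrix_vector_mult_def eigenfield_def eigenfield_grad_def strain_flow_def
          A_def c_def d_def) (simp add: field_simps)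
  qed
  also have "\<dots> = (\<integral>x. ((- 3/40) *\<^sub>R eigenfield x) \<bullet> \<phi> x \<partial>lborel)"
    unfolding rhs using Bochner_Integration.integral_add[OF iA iv] A0 by simp
  finally show "(\<integral>x. (- (1/2) *\<^sub>R eigenfield x - (1/2) *\<^sub>R (eigenfield_grad x *v x)
          + (eigenfield_grad x *v strain_flow x + strain_gradient *v eigenfield x)) \<bullet> \<phi> x
          + eigenfield_grad x \<bullet> jacobian_at \<phi> x \<partial>lborel)
      = (\<integral>x. ((- 3/40) *\<^sub>R eigenfield x) \<bullet> \<phi> x \<partial>lborel)" .
qed

theorem theorem2:
  "\<exists>(U :: real^3 \<Rightarrow> real^3) (v :: real^3 \<Rightarrow> real^3) (\<mu> :: real).
     U \<in> H1_loc \<and> v \<in> H1 \<and> \<not> (AE \<xi> in lborel. v \<xi> = 0) \<and> \<mu> < 0 \<and>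
     weak_profile_equation U \<and> weak_eigenvalue_equation U v \<mu> \<and>
     weakly_divergence_free U \<and> weakly_divergence_free v"
  by (rule exI[of _ strain_flow], rule exI[of _ eigenfield], rule exI[of _ "- 3/40"])
     (simp add: strain_flow_H1_loc eigenfield_H1 eigenfield_nonzero strain_flow_profile
      eigenfield_equation[simplified] strain_flow_divergence_free eigenfield_divergence_free)

end
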